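(* Let $n\ge 2$. The largest part of the parking partition $(gt_n,eq_n,lt_n)$ equals the largest part of the tree-poset partition $(R_n^{\cdot<0},R_n^{0<\cdot<1},R_n^{\cdot>1})$, that is, $$\max(gt_n,eq_n,lt_n)=\max(R_n^{\cdot<0},R_n^{0<\cdot<1},R_n^{\cdot>1}).$$ Hence the sorted parking partition majorises the sorted tree-poset partition.
   Context: A parking function of length $n$ is a sequence $(a_1,\dots,a_n)$ of integers in $\{0,1,\dots,n-1\}$ whose weakly increasing rearrangement $(b_1,\dots,b_n)$ satisfies $b_i<i$ for all $i$. Let $gt_n$, $eq_n$, $lt_n$ be the numbers of parking functions of length $n$ with $a_1>a_2$, $a_1=a_2$, $a_1<a_2$ respectively. The Shi arrangement $\mathcal S_n$ in $\mathbb R^n$ consists of the hyperplanes $x_i-x_j=0$ and $x_i-x_j=1$ for $1\le i<j\le n$; its regions are the connected components of the complement of the union of these hyperplanes. Let $R_n^{\cdot<0}$, $R_n^{0<\cdot<1}$, $R_n^{\cdot>1}$ be the numbers of regions of $\mathcal S_n$ all of whose points satisfy $x_1-x_2<0$, $0<x_1-x_2<1$, $x_1-x_2>1$ respectively. (Each of the two triples has sum $(n+1)^{n-1}$.) For triples sorted in weakly decreasing order $\lambda_1\ge\lambda_2\ge\lambda_3$ and $\mu_1\ge\mu_2\ge\mu_3$, $\lambda$ majorises $\mu$ if $\lambda_1\ge\mu_1$, $\lambda_1+\lambda_2\ge\mu_1+\mu_2$ and $\lambda_1+\lambda_2+\lambda_3=\mu_1+\mu_2+\mu_3$. *)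

theory Defs
  imports "HOL-Analysis.Analysis"
begin

definition parking_function :: "nat \<Rightarrow> nat list \<Rightarrow> bool" where
  "parking_function n a \<longleftrightarrow>
     length a = n \<and> set a \<subseteq> {0..<n} \<and> (\<forall>i\<in>{1..n}. sort a ! (i - 1) < i)"

(* Lists are indexed from 0, so a_1 and a_2 are a ! 0 and a ! 1. *)

definition parking_gt :: "nat \<Rightarrow> nat" where
  "parking_gt n = card {a. parking_function n a \<and> a ! 0 > a ! 1}"

definition parking_eq :: "nat \<Rightarrow> nat" where
  "parking_eq n = card {a. parking_function n a \<and> a ! 0 = a ! 1}"

definition parking_lt :: "nat \<Rightarrow> nat" where
  "parking_lt n = card {a. parking_function n a \<and> a ! 0 < a ! 1}"

(* R^n is Euclidean_space n, whose coordinates are indexed by 0, ..., n - 1;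
   the coordinates x_1 and x_2 are therefore x 0 and x 1. *)

definition shi_arrangement :: "nat \<Rightarrow> (nat \<Rightarrow> real) set set" where
  "shi_arrangement n =
     {{x \<in> topspace (Euclidean_space n). x i - x j = c} | i j c. i < j \<and> j < n \<and> c \<in> {0, 1}}"

definition shi_regions :: "nat \<Rightarrow> (nat \<Rightarrow> real) set set" where
  "shi_regions n =
     connected_components_of
       (subtopology (Euclidean_space n) (topspace (Euclidean_space n) - \<Union>(shi_arrangement n)))"

definition shi_neg :: "nat \<Rightarrow> nat" where
  "shi_neg n = card {C \<in> shi_regions n. \<forall>x\<in>C. x 0 - x 1 < 0}"

definition shi_mid :: "nat \<Rightarrow> nat" where
  "shi_mid n = card {C \<in> shi_regions n. \<forall>x\<in>C. 0 < x 0 - x 1 \<and> x 0 - x 1 < 1}"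

definition shi_above :: "nat \<Rightarrow> nat" where
  "shi_above n = card {C \<in> shi_regions n. \<forall>x\<in>C. x 0 - x 1 > 1}"

definition decreasing_sort :: "nat list \<Rightarrow> nat list" where
  "decreasing_sort xs = rev (sort xs)"

(* Meant for weakly decreasing lists of length 3. *)
definition majorises :: "nat list \<Rightarrow> nat list \<Rightarrow> bool" where
  "majorises l m \<longleftrightarrow>
     l ! 0 \<ge> m ! 0 \<and>
     l ! 0 + l ! 1 \<ge> m ! 0 + m ! 1 \<and>
     l ! 0 + l ! 1 + l ! 2 = m ! 0 + m ! 1 + m ! 2"

end

theory Submission
  imports Defs
begin

text \<open>
  By Pollak's cyclic argument there are \<open>(n+1)\<^sup>n\<^sup>-\<^sup>1\<close> parking functions, \<open>(n+1)\<^sup>n\<^sup>-\<^sup>2\<close> of them with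
  \<open>a\<^sub>1 = a\<^sub>2\<close>; the swap of \<open>a\<^sub>1\<close> and \<open>a\<^sub>2\<close> gives \<open>gt\<^sub>n = lt\<^sub>n\<close>.
  On the other side let \<open>H\<close> be the hyperplane \<open>x\<^sub>1 - x\<^sub>2 = 1\<close>. Without \<open>H\<close> the Shi arrangement is
  invariant under swapping \<open>x\<^sub>1\<close> and \<open>x\<^sub>2\<close>, so it has \<open>2R\<close> regions, where \<open>R\<close> is the number of
  regions with \<open>x\<^sub>1 < x\<^sub>2\<close>. The regions on either side of \<open>H\<close> with \<open>x\<^sub>1 > x\<^sub>2\<close> inject into
  those of the arrangement without \<open>H\<close>, so neither family has more than \<open>R\<close> members.
  Deletion and restriction at \<open>H\<close> now give \<open>2R = (n+1)\<^sup>n\<^sup>-\<^sup>1 - (n+1)\<^sup>n\<^sup>-\<^sup>2\<close>, the two terms being the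
  region counts of the Shi arrangement and of its restriction to \<open>H\<close>. Both counts come from the
  finite field method: modulo \<open>q\<close>, the complements have \<open>q(q-n)\<^sup>n\<^sup>-\<^sup>1\<close> and \<open>q(q-n)\<^sup>n\<^sup>-\<^sup>2\<close> points.
\<close>

section \<open>Parking functions\<close>

text \<open>The \<open>i\<close>-th smallest entry is below \<open>i\<close> exactly when at least
  \<open>i\<close> entries are below \<open>i\<close>, and such counts do not see the order of the
  list. The instance \<open>k = n\<close> already forces all entries into
  \<open>{0..<n}\<close>.\<close>

lemma parking_function_iff:
  "parking_function n a \<longleftrightarrow>
     length a = n \<and> (\<forall>k\<le>n. k \<le> length (filter (\<lambda>x. x < k) a))"
proof -
  have sorted_nth: "(\<forall>i\<in>{1..length b}. b ! (i - 1) < i) \<longleftrightarrow>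
      (\<forall>k\<le>length b. k \<le> length (filter (\<lambda>x. x < k) b))" if "sorted b" for b :: "nat list"
  proof -
    have "b ! (k - 1) < k \<longleftrightarrow> k \<le> length (filter (\<lambda>x. x < k) b)"
      if k: "1 \<le> k" "k \<le> length b" for k
    proof
      assume *: "b ! (k - 1) < k"
      have "{..<k} \<subseteq> {i. i < length b \<and> b ! i < k}"
      proof
        fix i assume "i \<in> {..<k}"
        then have "i \<le> k - 1" "k - 1 < length b" using k by auto
        then show "i \<in> {i. i < length b \<and> b ! i < k}"
          using sorted_nth_mono[OF \<open>sorted b\<close>, of i "k - 1"] * by auto
      qed
      then have "card {..<k} \<le> card {i. i < length b \<and> b ! i < k}" by (intro card_mono) auto
      then show "k \<le> length (filter (\<lambda>x. x < k) b)" by (simp add: length_filter_conv_card)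
    next
      assume *: "k \<le> length (filter (\<lambda>x. x < k) b)"
      show "b ! (k - 1) < k"
      proof (rule ccontr)
        assume **: "\<not> b ! (k - 1) < k"
        have "{i. i < length b \<and> b ! i < k} \<subseteq> {..<k - 1}"
        proof
          fix i assume i: "i \<in> {i. i < length b \<and> b ! i < k}"
          then show "i \<in> {..<k - 1}"
            using sorted_nth_mono[OF \<open>sorted b\<close>, of "k - 1" i] ** by (cases "k - 1 \<le> i") auto
        qed
        then have "card {i. i < length b \<and> b ! i < k} \<le> card {..<k - 1}" by (intro card_mono) auto
        then show False using * k by (simp add: length_filter_conv_card)
      qed
    qed
    then show ?thesis by (metis One_nat_def Suc_leI atLeastAtMost_iff le0 not_gr_zero)
  qed
  have filter_sort: "length (filter Q (sort a)) = length (filter Q a)" for Q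
    by (metis filter_sort length_sort)
  have "set a \<subseteq> {0..<n}" if "length a = n" "\<forall>k\<le>n. k \<le> length (filter (\<lambda>x. x < k) a)"
    using that by (metis (mono_tags, lifting) atLeastLessThan_iff filter_True
      filter_id_conv le0 le_antisym length_filter_le length_filter_less nat_less_le order_refl subsetI)
  then show ?thesis
    unfolding parking_function_def using sorted_nth[of "sort a"] filter_sort by auto
qed

section \<open>Pollak's rotation argument\<close>

lemma exists_unique_first_minimum:
  fixes D :: "nat \<Rightarrow> int"
  shows "\<exists>!t. t \<le> n \<and> (\<forall>j\<le>n. D t \<le> D j) \<and> (\<forall>j<t. D t < D j)"
proof -
  define m where "m = Min (D ` {..n})"
  have m: "m \<le> D j" if "j \<le> n" for j unfolding m_def using that by auto
  have "m \<in> D ` {..n}" unfolding m_def by (rule Min_in) auto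
  then have ex: "\<exists>t. t \<le> n \<and> D t = m" by auto
  define t where "t = (LEAST t. t \<le> n \<and> D t = m)"
  have t: "t \<le> n" "D t = m" unfolding t_def using LeastI_ex[OF ex] by auto
  have less: "m < D j" if "j < t" for j
    using not_less_Least[of j "\<lambda>t. t \<le> n \<and> D t = m"] that m[of j] t(1) unfolding t_def by force
  show ?thesis
  proof (intro ex1I[of _ t])
    show "t \<le> n \<and> (\<forall>j\<le>n. D t \<le> D j) \<and> (\<forall>j<t. D t < D j)" using t m less by auto
    fix u assume u: "u \<le> n \<and> (\<forall>j\<le>n. D u \<le> D j) \<and> (\<forall>j<u. D u < D j)"
    then have "D u \<le> D t" using t(1) by blast
    then have "D u = D t" using t(2) m[of u] u by simp
    then have "\<not> t < u" "\<not> u < t" using u less[of u] t(2) by auto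
    then show "u = t" by simp
  qed
qed

text \<open>For \<open>t \<le> n\<close> this subtracts \<open>t\<close> modulo
  \<open>n + 1\<close>: position \<open>t\<close> of the circle becomes position 0. Adding
  \<open>Suc n - t\<close> avoids truncated subtraction on naturals.\<close>

definition rotate_values :: "nat \<Rightarrow> nat \<Rightarrow> nat list \<Rightarrow> nat list" where
  "rotate_values n t = map (\<lambda>x. (x + (Suc n - t)) mod Suc n)"

lemma unique_parking_rotation:
  assumes "length b = n" "set b \<subseteq> {..n}"
  shows "\<exists>!t. t \<le> n \<and> parking_function n (rotate_values n t b)"
proof -
  define c where "c = (\<lambda>k. length (filter (\<lambda>x. x < k) b))"
  \<comment> \<open>The rotation starting at \<open>t\<close> parks iff \<open>t\<close> is the first minimum of this walk.\<close>
  define D where "D = (\<lambda>k. int (c k) - int k)"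
  have c_add: "c (u + v) = c u + length (filter (\<lambda>x. u \<le> x \<and> x < u + v) b)" for u v
    unfolding c_def by (induction b) auto
  have cN: "c (Suc n) = n"
  proof -
    have "filter (\<lambda>x. x < Suc n) b = b" using assms(2) by (intro filter_True) auto
    then show ?thesis using assms(1) by (simp add: c_def)
  qed
  \<comment> \<open>The entries below \<open>k\<close> after rotation are the entries of
    \<open>b\<close> on the cyclic arc of length \<open>k\<close> that starts at \<open>t\<close>;
    the second branch is the arc that wraps past \<open>n\<close>.\<close>
  have rot: "length (filter (\<lambda>x. x < k) (rotate_values n t b)) =
      (if t + k \<le> Suc n then c (t + k) - c t else n - c t + c (t + k - Suc n))"
    if t: "t \<le> n" and k: "k \<le> n" for t k
  proof -
    have mod_less: "(x + (Suc n - t)) mod Suc n < k \<longleftrightarrow>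
        (if t + k \<le> Suc n then t \<le> x \<and> x < t + k else t \<le> x \<or> x < t + k - Suc n)"
      if "x \<in> set b" for x
    proof (cases "t \<le> x")
      case True
      then have "x + (Suc n - t) = (x - t) + Suc n" using t by simp
      then have "(x + (Suc n - t)) mod Suc n = (x - t) mod Suc n" by (metis mod_add_self2)
      moreover have "\<dots> = x - t" using that assms(2) by (intro mod_less) auto
      ultimately have *: "(x + (Suc n - t)) mod Suc n = x - t" by simp
      have "x \<le> n" using that assms(2) by auto
      then show ?thesis unfolding * using True t by auto
    next
      case False
      then have *: "(x + (Suc n - t)) mod Suc n = x + (Suc n - t)" using t by simp
      show ?thesis unfolding * using False t k by auto
    qed
    have "length (filter (\<lambda>x. x < k) (rotate_values n t b)) =
        length (filter (\<lambda>x. (x + (Suc n - t)) mod Suc n < k) b)"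
      by (simp add: rotate_values_def filter_map o_def)
    also have "filter (\<lambda>x. (x + (Suc n - t)) mod Suc n < k) b =
      filter (\<lambda>x. if t + k \<le> Suc n then t \<le> x \<and> x < t + k else t \<le> x \<or> x < t + k - Suc n) b"
      using mod_less by (intro filter_cong) auto
    also have "length \<dots> = (if t + k \<le> Suc n then c (t + k) - c t else n - c t + c (t + k - Suc n))"
    proof (cases "t + k \<le> Suc n")
      case True
      then show ?thesis using c_add[of t k] by simp
    next
      case False
      have "length (filter (\<lambda>x. t \<le> x \<or> x < t + k - Suc n) b) + c t = length b + c (t + k - Suc n)"
        unfolding c_def using False k by (induction b) auto
      moreover have "c t \<le> n" using assms(1) length_filter_le[of _ b] by (simp add: c_def)
      ultimately show ?thesis using False assms(1) by simp
    qed
    finally show ?thesis .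
  qed
  have c_mono: "c u \<le> c v" if "u \<le> v" for u v using c_add[of u "v - u"] that by simp
  have "parking_function n (rotate_values n t b) \<longleftrightarrow>
      (\<forall>j\<le>n. D t \<le> D j) \<and> (\<forall>j<t. D t < D j)" if t: "t \<le> n" for t
  proof -
    have "parking_function n (rotate_values n t b) \<longleftrightarrow>
      (\<forall>k\<le>n. k \<le> (if t + k \<le> Suc n then c (t + k) - c t else n - c t + c (t + k - Suc n)))"
      unfolding parking_function_iff using rot[OF t] assms(1) by (simp add: rotate_values_def)
    \<comment> \<open>Since \<open>D (Suc n) = -1\<close>, a full turn lowers the walk by one. An
      arc that wraps around to some \<open>j < t\<close> thus demands the strict
      \<open>D t < D j\<close>, while an arc ending at \<open>j \<ge> t\<close> demands only
      \<open>D t \<le> D j\<close>.\<close>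
    also have "\<dots> \<longleftrightarrow> (\<forall>j\<le>n. D t \<le> D j) \<and> (\<forall>j<t. D t < D j)"
    proof (intro iffI conjI allI impI)
      assume *: "\<forall>k\<le>n. k \<le> (if t + k \<le> Suc n then c (t + k) - c t else n - c t + c (t + k - Suc n))"
      show less: "D t < D j" if "j < t" for j
      proof -
        define k where "k = j + Suc n - t"
        have k: "k \<le> n" "t + k = j + Suc n" using that t by (auto simp: k_def)
        have "c t \<le> n" using c_mono[of t "Suc n"] cN t by simp
        moreover have "k \<le> n - c t + c j"
        \<comment> \<open>For \<open>j = 0\<close> the arc ends exactly at \<open>Suc n\<close>,
          which the non-wrapping branch of the count covers.\<close>
        proof (cases "j = 0")
          case True
          have "c 0 = 0" by (simp add: c_def)
          then show ?thesis using *[rule_format, OF k(1)] k(2) cN True by simp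
        next
          case False
          then show ?thesis using *[rule_format, OF k(1)] k(2) by simp
        qed
        ultimately show ?thesis using k(2) unfolding D_def by linarith
      qed
      show "D t \<le> D j" if "j \<le> n" for j
      proof (cases "j < t")
        case False
        then have "j - t \<le> c j - c t" using *[rule_format, of "j - t"] that by simp
        then show ?thesis using False c_mono[of t j] by (simp add: D_def)
      qed (use less in force)
    next
      assume *: "(\<forall>j\<le>n. D t \<le> D j) \<and> (\<forall>j<t. D t < D j)"
      fix k assume k: "k \<le> n"
      have ct: "c t \<le> n" using c_mono[of t "Suc n"] cN t by simp
      consider "t + k \<le> n" | "t + k = Suc n" | "t + k > Suc n" by linarith
      then show "k \<le> (if t + k \<le> Suc n then c (t + k) - c t else n - c t + c (t + k - Suc n))"
      proof cases
        case 1
        then have "D t \<le> D (t + k)" using * by blast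
        then show ?thesis using 1 by (simp add: D_def)
      next
        case 2
        then have "D t < D 0" using * k by simp
        then show ?thesis using 2 cN ct by (simp add: D_def c_def)
      next
        case 3
        then have "t + k - Suc n < t" using k by simp
        then have "D t < D (t + k - Suc n)" using * by blast
        then show ?thesis using 3 ct by (simp add: D_def)
      qed
    qed
    finally show ?thesis .
  qed
  then show ?thesis using exists_unique_first_minimum[of n D] by (smt (verit))
qed

lemma eq_of_rotated_eq:
  fixes x y k :: nat
  assumes "x \<le> n" "y \<le> n" "(x + k) mod Suc n = (y + k) mod Suc n"
  shows "x = y"
proof -
  have "(int x + int k) mod int (Suc n) = (int y + int k) mod int (Suc n)"
    using assms(3) by (metis of_nat_add of_nat_mod)
  then have "int (Suc n) dvd int x - int y" by (simp add: mod_eq_dvd_iff)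
  then show ?thesis using assms(1,2) dvd_imp_le_int[of "int x - int y" "int (Suc n)"] by force
qed

text \<open>Count the pairs of a shift \<open>t\<close> and a list \<open>b\<close> whose rotation
  parks. Each of the \<open>n + 1\<close> shifts permutes the lists satisfying \<open>R\<close>, and
  each such list parks for exactly one shift. The invariant predicate \<open>R\<close> allows the
  same count with and without the condition that the first two entries agree.\<close>

lemma card_parking_pollak:
  fixes R :: "nat list \<Rightarrow> bool"
  assumes inv: "\<And>t b. t \<le> n \<Longrightarrow> length b = n \<Longrightarrow> set b \<subseteq> {..n} \<Longrightarrow> R (rotate_values n t b) \<longleftrightarrow> R b"
  shows "Suc n * card {a. parking_function n a \<and> R a} =
    card {b. set b \<subseteq> {..n} \<and> length b = n \<and> R b}"
proof -
  define X where "X = {b. set b \<subseteq> {..n} \<and> length b = n \<and> R b}"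
  define A where "A = {a. parking_function n a \<and> R a}"
  let ?T = "rotate_values n"
  have finX: "finite X" unfolding X_def
    by (rule finite_subset[OF _ finite_lists_length_eq[of "{..n}" n]]) auto
  have AX: "A \<subseteq> X" by (auto simp: A_def X_def parking_function_def)
  have TX: "?T t b \<in> X" if "t \<le> n" "b \<in> X" for t b
  proof -
    have "set (?T t b) \<subseteq> {..n}"
      by (auto simp: rotate_values_def less_Suc_eq_le[symmetric])
    then show ?thesis using that inv by (auto simp: X_def rotate_values_def)
  qed
  have T_inj: "inj_on (?T t) X" if "t \<le> n" for t
  proof (rule inj_onI)
    fix b b' assume b: "b \<in> X" "b' \<in> X" and eq: "?T t b = ?T t b'"
    from eq_of_rotated_eq
    have "inj_on (\<lambda>x. (x + (Suc n - t)) mod Suc n) {..n}" by (auto intro: inj_onI)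
    then show "b = b'" using b eq unfolding rotate_values_def X_def
      by (intro map_inj_on[OF eq[unfolded rotate_values_def]]) (auto intro: inj_on_subset)
  qed
  have T_bij: "?T t ` X = X" if "t \<le> n" for t
    by (rule endo_inj_surj[OF finX _ T_inj]) (use TX that in auto)
  have "card {b \<in> X. ?T t b \<in> A} = card A" if "t \<le> n" for t
  proof (rule bij_betw_same_card[of "?T t"])
    show "bij_betw (?T t) {b \<in> X. ?T t b \<in> A} A"
      unfolding bij_betw_def using T_inj[OF that] T_bij[OF that] AX
      by (auto intro: inj_on_subset)
  qed
  then have "Suc n * card A = (\<Sum>t\<le>n. card {b \<in> X. ?T t b \<in> A})" by simp
  also have "\<dots> = (\<Sum>b\<in>X. card {t \<in> {..n}. ?T t b \<in> A})"
    by (rule sum_multicount_gen) (use finX in auto)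
  also have "\<dots> = (\<Sum>b\<in>X. 1)"
  proof (rule sum.cong)
    fix b assume b: "b \<in> X"
    then have "\<exists>!t. t \<le> n \<and> parking_function n (?T t b)"
      by (intro unique_parking_rotation) (auto simp: X_def)
    then have "\<exists>!t. t \<in> {t \<in> {..n}. ?T t b \<in> A}" using b inv by (auto simp: A_def X_def)
    then show "card {t \<in> {..n}. ?T t b \<in> A} = 1" by (metis (no_types, lifting) card_1_singleton_iff is_singletonI' is_singleton_def empty_iff One_nat_def)
  qed simp
  finally show ?thesis by (simp add: A_def X_def)
qed

section \<open>Counting parking functions by their first two entries\<close>

lemma card_parking_functions: "Suc n * card {a. parking_function n a} = Suc n ^ n"
  using card_parking_pollak[of n "\<lambda>_. True"] card_lists_length_eq[of "{..n}" n] by simp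

text \<open>Rotation is injective on residues, so equality of the first two entries is invariant and
  Pollak's count applies. The lists counted arise uniquely by doubling the head of a list of length
  \<open>n - 1\<close>.\<close>

lemma card_parking_eq:
  assumes "n \<ge> 2"
  shows "Suc n * parking_eq n = Suc n ^ (n - 1)"
proof -
  have "Suc n * parking_eq n = card {b. set b \<subseteq> {..n} \<and> length b = n \<and> b ! 0 = b ! 1}"
    unfolding parking_eq_def
  proof (rule card_parking_pollak)
    fix t and b :: "nat list" assume b: "length b = n" "set b \<subseteq> {..n}"
    then have "b ! 0 \<in> set b" "b ! 1 \<in> set b" using assms by auto
    then have "b ! 0 \<le> n" "b ! 1 \<le> n" using b by auto
    then show "rotate_values n t b ! 0 = rotate_values n t b ! 1 \<longleftrightarrow> b ! 0 = b ! 1"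
      using eq_of_rotated_eq b assms by (auto simp: rotate_values_def nth_map)
  qed
  also have "{b. set b \<subseteq> {..n} \<and> length b = n \<and> b ! 0 = b ! 1} =
      (\<lambda>b. hd b # b) ` {b. set b \<subseteq> {..n} \<and> length b = n - 1}"
  proof (intro equalityI subsetI)
    fix b assume b: "b \<in> {b. set b \<subseteq> {..n} \<and> length b = n \<and> b ! 0 = b ! 1}"
    then obtain x y r where "b = x # y # r" using assms
      by (cases b; cases "tl b") auto
    then show "b \<in> (\<lambda>b. hd b # b) ` {b. set b \<subseteq> {..n} \<and> length b = n - 1}"
      using b by (intro image_eqI[of _ _ "y # r"]) auto
  next
    fix b assume "b \<in> (\<lambda>b. hd b # b) ` {b. set b \<subseteq> {..n} \<and> length b = n - 1}"
    then obtain r where "b = hd r # r" "set r \<subseteq> {..n}" "length r = n - 1" by auto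
    then show "b \<in> {b. set b \<subseteq> {..n} \<and> length b = n \<and> b ! 0 = b ! 1}"
      using assms by (cases r) auto
  qed
  also have "card \<dots> = card {b. set b \<subseteq> {..n} \<and> length b = n - 1}"
    by (intro card_image inj_onI) auto
  also have "\<dots> = Suc n ^ (n - 1)" using card_lists_length_eq[of "{..n}" "n - 1"] by simp
  finally show ?thesis .
qed

lemma parking_gt_eq_lt:
  assumes "n \<ge> 2"
  shows "parking_gt n = parking_lt n"
proof -
  define s where "s = (\<lambda>a::nat list. a[0 := a ! 1, 1 := a ! 0])"
  have s: "parking_function n (s a)" "s (s a) = a" "s a ! 0 = a ! 1" "s a ! 1 = a ! 0"
    if pf: "parking_function n a" for a
  proof -
    obtain x y r where a: "a = x # y # r" using assms pf
      by (cases a; cases "tl a") (auto simp: parking_function_iff)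
    show "parking_function n (s a)" "s (s a) = a" "s a ! 0 = a ! 1" "s a ! 1 = a ! 0"
      using pf by (auto simp: s_def a parking_function_iff)
  qed
  have "bij_betw s {a. parking_function n a \<and> a ! 0 > a ! 1} {a. parking_function n a \<and> a ! 0 < a ! 1}"
    by (rule bij_betwI[where g = s]) (use s in auto)
  then show ?thesis unfolding parking_gt_def parking_lt_def by (rule bij_betw_same_card)
qed

lemma parking_total:
  "parking_gt n + parking_eq n + parking_lt n = card {a. parking_function n a}"
proof -
  have fin: "finite {a. parking_function n a}"
    by (rule finite_subset[OF _ finite_lists_length_eq[of "{0..<n}" n]]) (auto simp: parking_function_def)
  let ?G = "{a. parking_function n a \<and> a ! 0 > a ! 1}" and ?E = "{a. parking_function n a \<and> a ! 0 = a ! 1}"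
  let ?L = "{a. parking_function n a \<and> a ! 0 < a ! 1}"
  have "{a. parking_function n a} = ?G \<union> (?E \<union> ?L)" by auto
  moreover have "finite ?G" "finite ?E" "finite ?L" by (auto intro: finite_subset[OF _ fin])
  moreover have "?G \<inter> (?E \<union> ?L) = {}" "?E \<inter> ?L = {}" by auto
  ultimately show ?thesis unfolding parking_gt_def parking_eq_def parking_lt_def
    by (simp only: card_Un_disjoint finite_UnI add.assoc)
qed

section \<open>Deletion and restriction for deformations of the braid arrangement\<close>

text \<open>A triple \<open>(i, j, c)\<close> stands for the hyperplane \<open>x\<^sub>i - x\<^sub>j = c\<close>, and a region for the set of
  triples on whose positive side it lies. Coordinates outside the index range do not affect patterns.\<close>

definition hval :: "nat \<times> nat \<times> int \<Rightarrow> (nat \<Rightarrow> real) \<Rightarrow> real" where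
  "hval = (\<lambda>(i, j, c) x. x i - x j - of_int c)"

definition generic :: "(nat \<times> nat \<times> int) set \<Rightarrow> (nat \<Rightarrow> real) set" where
  "generic E = {x. \<forall>e\<in>E. hval e x \<noteq> 0}"

definition pos_side :: "(nat \<times> nat \<times> int) set \<Rightarrow> (nat \<Rightarrow> real) \<Rightarrow> (nat \<times> nat \<times> int) set" where
  "pos_side E x = {e \<in> E. hval e x > 0}"

definition patterns :: "(nat \<times> nat \<times> int) set \<Rightarrow> (nat \<times> nat \<times> int) set set" where
  "patterns E = pos_side E ` generic E"

text \<open>The hyperplane \<open>(i, j, d)\<close> after the substitution \<open>x\<^sub>a = x\<^sub>b + c\<close>.\<close>

definition restrict_edge :: "nat \<times> nat \<times> int \<Rightarrow> nat \<times> nat \<times> int \<Rightarrow> nat \<times> nat \<times> int" where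
  "restrict_edge = (\<lambda>(a, b, c) (i, j, d).
     (if i = a then b else i, if j = a then b else j,
      d - (if i = a then c else 0) + (if j = a then c else 0)))"

lemma hval_simp [simp]: "hval (i, j, c) x = x i - x j - of_int c"
  by (simp add: hval_def)

lemma hval_segment:
  "hval e (\<lambda>i. (1 - t) * x i + t * y i) = (1 - t) * hval e x + t * hval e y"
  by (cases e) (simp add: algebra_simps)

lemma hval_restrict_edge:
  assumes "a \<noteq> b"
  shows "hval (restrict_edge (a, b, c) e) x = hval e (x(a := x b + of_int c))"
  using assms by (cases e) (auto simp: restrict_edge_def)

text \<open>Compares numbers of sign patterns through a map \<open>\<phi>\<close> between points.
  The map may fail to be injective; it only has to identify the classes of \<open>f\<close> with
  those of \<open>g\<close>.\<close>

lemma card_image_eq_if_kernel_eq: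
  assumes "\<phi> ` X = Y" "\<And>x x'. x \<in> X \<Longrightarrow> x' \<in> X \<Longrightarrow> f x = f x' \<longleftrightarrow> g (\<phi> x) = g (\<phi> x')"
  shows "card (f ` X) = card (g ` Y)"
proof -
  define u where "u = (\<lambda>A. g (\<phi> (inv_into X f A)))"
  have u: "u (f x) = g (\<phi> x)" if "x \<in> X" for x
  proof -
    have "inv_into X f (f x) \<in> X" "f (inv_into X f (f x)) = f x"
      using that by (auto intro: inv_into_into f_inv_into_f)
    then show ?thesis unfolding u_def using assms(2)[OF _ that] by blast
  qed
  have "bij_betw u (f ` X) (g ` Y)"
    unfolding bij_betw_def inj_on_def using u assms by (force simp: image_iff)
  then show ?thesis by (rule bij_betw_same_card)
qed

lemma finite_patterns: "finite E \<Longrightarrow> finite (patterns E)"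
  by (rule finite_subset[of _ "Pow E"]) (auto simp: patterns_def pos_side_def)

lemma pos_side_eq_iff: "pos_side E x = pos_side E y \<longleftrightarrow> (\<forall>e\<in>E. hval e x > 0 \<longleftrightarrow> hval e y > 0)"
  by (auto simp: pos_side_def)

text \<open>Cells are convex: along a segment each \<open>hval e\<close> is a convex combination of
  two nonzero values of the same sign.\<close>

lemma pos_side_segment:
  assumes "x \<in> generic E" "y \<in> generic E" "pos_side E x = pos_side E y" "0 \<le> t" "t \<le> 1"
  defines "z \<equiv> \<lambda>i. (1 - t) * x i + t * y i"
  shows "z \<in> generic E" "pos_side E z = pos_side E x"
proof -
  have "hval e z \<noteq> 0 \<and> (hval e z > 0 \<longleftrightarrow> hval e x > 0)" if "e \<in> E" for e
  proof -
    have z: "hval e z = (1 - t) * hval e x + t * hval e y"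
      unfolding z_def by (rule hval_segment)
    have ne: "hval e x \<noteq> 0" "hval e y \<noteq> 0" and same: "hval e x > 0 \<longleftrightarrow> hval e y > 0"
      using assms that by (auto simp: generic_def pos_side_eq_iff)
    show ?thesis
    proof (cases "hval e x > 0")
      case True
      then have "hval e z > 0" unfolding z using same assms(4,5)
        by (cases "t = 1") (auto intro!: add_pos_nonneg)
      then show ?thesis using True by simp
    next
      case False
      then have "hval e x < 0" "hval e y < 0" using ne same by auto
      then have "hval e z < 0" unfolding z using assms(4,5)
        by (cases "t = 1") (auto intro!: add_neg_nonpos mult_pos_neg mult_nonneg_nonpos)
      then show ?thesis using False by simp
    qed
  qed
  then show "z \<in> generic E" "pos_side E z = pos_side E x"
    by (auto simp: generic_def pos_side_def)
qed

text \<open>Finitely many nonzero values are bounded away from 0, and moving a single coordinate by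
  \<open>t\<close> changes each of them by at most \<open>\<bar>t\<bar>\<close>.\<close>

lemma generic_perturb:
  assumes "finite F" "x \<in> generic F"
  obtains \<epsilon> where "\<epsilon> > 0"
    "\<And>t a. \<bar>t\<bar> \<le> \<epsilon> \<Longrightarrow> x(a := x a + t) \<in> generic F \<and> pos_side F (x(a := x a + t)) = pos_side F x"
proof -
  have "\<exists>\<epsilon>>0. \<forall>e\<in>F. \<bar>hval e x\<bar> > \<epsilon>"
  proof (cases "F = {}")
    case False
    define m where "m = Min ((\<lambda>e. \<bar>hval e x\<bar>) ` F)"
    have "m > 0" unfolding m_def using assms False by (auto simp: generic_def)
    moreover have "\<bar>hval e x\<bar> \<ge> m" if "e \<in> F" for e unfolding m_def using assms that by auto
    ultimately show ?thesis by (intro exI[of _ "m / 2"]) force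
  qed (auto intro: exI[of _ 1])
  then obtain \<epsilon> where \<epsilon>: "\<epsilon> > 0" "\<And>e. e \<in> F \<Longrightarrow> \<bar>hval e x\<bar> > \<epsilon>" by blast
  have "hval e (x(a := x a + t)) \<noteq> 0 \<and> (hval e (x(a := x a + t)) > 0 \<longleftrightarrow> hval e x > 0)"
    if "\<bar>t\<bar> \<le> \<epsilon>" "e \<in> F" for t a e
  proof -
    have "\<bar>hval e (x(a := x a + t)) - hval e x\<bar> \<le> \<bar>t\<bar>" by (cases e) auto
    then show ?thesis using \<epsilon>(2)[OF that(2)] that(1) by linarith
  qed
  then show ?thesis using \<epsilon>(1) by (intro that[of \<epsilon>]) (auto simp: generic_def pos_side_def)
qed

text \<open>A point on \<open>h\<close> can be pushed off to either side without changing its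
  pattern over \<open>F\<close>. Conversely, if a pattern occurs on both sides, the segment between
  two witnesses crosses \<open>h\<close> inside the same cell.\<close>

lemma patterns_split:
  fixes a b :: nat and c :: int
  assumes "finite F" "a \<noteq> b"
  defines "h \<equiv> (a, b, c)"
  defines "U \<equiv> pos_side F ` {x \<in> generic F. hval h x > 0}"
  defines "L \<equiv> pos_side F ` {x \<in> generic F. hval h x < 0}"
  shows "U \<union> L = patterns F"
    and "U \<inter> L = pos_side F ` {x \<in> generic F. hval h x = 0}"
proof -
  have pert: "pos_side F x \<in> U \<inter> L" if x: "x \<in> generic F" "hval h x = 0" for x
  proof -
    obtain \<epsilon> where \<epsilon>: "\<epsilon> > 0"
      "\<And>t a. \<bar>t\<bar> \<le> \<epsilon> \<Longrightarrow> x(a := x a + t) \<in> generic F \<and> pos_side F (x(a := x a + t)) = pos_side F x"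
      using generic_perturb[OF assms(1) x(1)] by blast
    have t: "hval h (x(a := x a + t)) = t" for t using x(2) assms(2) by (simp add: h_def)
    have "pos_side F x \<in> U" unfolding U_def using \<epsilon>(1) \<epsilon>(2)[of \<epsilon> a] t[of \<epsilon>]
      by (intro image_eqI[of _ _ "x(a := x a + \<epsilon>)"]) auto
    moreover have "pos_side F x \<in> L" unfolding L_def
      using \<epsilon>(1) \<epsilon>(2)[of "-\<epsilon>" a] t[of "-\<epsilon>"]
      by (intro image_eqI[of _ _ "x(a := x a + - \<epsilon>)"]) auto
    ultimately show ?thesis by blast
  qed
  show "U \<union> L = patterns F"
  proof
    show "U \<union> L \<subseteq> patterns F" by (auto simp: U_def L_def patterns_def)
    show "patterns F \<subseteq> U \<union> L"
    proof
      fix Q assume "Q \<in> patterns F"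
      then obtain x where x: "x \<in> generic F" "Q = pos_side F x" by (auto simp: patterns_def)
      then show "Q \<in> U \<union> L" using pert[of x]
        by (cases "hval h x" "0::real" rule: linorder_cases) (auto simp: U_def L_def)
    qed
  qed
  show "U \<inter> L = pos_side F ` {x \<in> generic F. hval h x = 0}"
  proof
    show "pos_side F ` {x \<in> generic F. hval h x = 0} \<subseteq> U \<inter> L" using pert by blast
    show "U \<inter> L \<subseteq> pos_side F ` {x \<in> generic F. hval h x = 0}"
    proof
      fix Q assume "Q \<in> U \<inter> L"
      then obtain x y where x: "x \<in> generic F" "hval h x > 0" "Q = pos_side F x"
        and y: "y \<in> generic F" "hval h y < 0" "Q = pos_side F y"
        by (auto simp: U_def L_def)
      \<comment> \<open>The parameter at which the affine function \<open>hval h\<close> vanishes on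
        the segment from \<open>x\<close> to \<open>y\<close>.\<close>
      define t where "t = hval h x / (hval h x - hval h y)"
      define z where "z = (\<lambda>i. (1 - t) * x i + t * y i)"
      have t: "0 \<le> t" "t \<le> 1" unfolding t_def using x(2) y(2) by auto
      have "z \<in> generic F" "pos_side F z = Q"
        using pos_side_segment[OF x(1) y(1) _ t] x y by (auto simp: z_def)
      moreover have "hval h z = 0"
        unfolding z_def hval_segment t_def using x(2) y(2) by (simp add: field_simps)
      ultimately show "Q \<in> pos_side F ` {x \<in> generic F. hval h x = 0}" by auto
    qed
  qed
qed

text \<open>The substitution \<open>x a = x b + c\<close> maps the generic points of the restricted
  arrangement onto the generic points of \<open>F\<close> on the hyperplane. It forgets the old
  value of \<open>x a\<close>, which is harmless because no restricted triple mentions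
  \<open>a\<close>.\<close>

lemma card_patterns_restriction:
  assumes "a \<noteq> b"
  shows "card (pos_side F ` {x \<in> generic F. hval (a, b, c) x = 0}) =
    card (patterns (restrict_edge (a, b, c) ` F))"
proof -
  let ?r = "restrict_edge (a, b, c)" and ?s = "\<lambda>x. x(a := x b + of_int c)"
  have "?s ` generic (?r ` F) = {x \<in> generic F. hval (a, b, c) x = 0}"
  proof
    show "?s ` generic (?r ` F) \<subseteq> {x \<in> generic F. hval (a, b, c) x = 0}"
      using assms by (auto simp: generic_def hval_restrict_edge)
    show "{x \<in> generic F. hval (a, b, c) x = 0} \<subseteq> ?s ` generic (?r ` F)"
    proof
      fix x assume x: "x \<in> {x \<in> generic F. hval (a, b, c) x = 0}"
      then have "?s x = x" by (auto simp: fun_eq_iff)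
      moreover from this x have "x \<in> generic (?r ` F)"
        using assms by (simp add: generic_def hval_restrict_edge)
      ultimately show "x \<in> ?s ` generic (?r ` F)" by (intro image_eqI[of _ _ x]) simp_all
    qed
  qed
  then show ?thesis unfolding patterns_def
    by (intro card_image_eq_if_kernel_eq[symmetric])
      (auto simp: pos_side_eq_iff hval_restrict_edge[OF assms])
qed

lemma pos_side_insert:
  "pos_side (insert h F) x = (if hval h x > 0 then insert h (pos_side F x) else pos_side F x)"
  by (auto simp: pos_side_def)

text \<open>A pattern over \<open>insert h F\<close> is a pattern over \<open>F\<close> together
  with a side of \<open>h\<close> on which it is realised. The predicate \<open>R\<close> makes it
  possible to impose the side of a second hyperplane at the same time.\<close>

lemma card_patterns_insert_halves:
  assumes "finite F" "h \<notin> F"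
  shows "card {P \<in> patterns (insert h F). h \<in> P \<and> R (P - {h})} =
      card {Q \<in> pos_side F ` {x \<in> generic F. hval h x > 0}. R Q}"
    and "card {P \<in> patterns (insert h F). h \<notin> P \<and> R P} =
      card {Q \<in> pos_side F ` {x \<in> generic F. hval h x < 0}. R Q}"
proof -
  have notin: "h \<notin> pos_side F x" for x using assms by (auto simp: pos_side_def)
  have "{P \<in> patterns (insert h F). h \<in> P \<and> R (P - {h})} =
      insert h ` {Q \<in> pos_side F ` {x \<in> generic F. hval h x > 0}. R Q}"
  proof (intro equalityI subsetI)
    fix P assume "P \<in> {P \<in> patterns (insert h F). h \<in> P \<and> R (P - {h})}"
    then obtain x where x: "x \<in> generic F" "P = pos_side (insert h F) x" "h \<in> P" "R (P - {h})"
      by (auto simp: patterns_def generic_def)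
    then have "hval h x > 0" "P = insert h (pos_side F x)"
      using notin by (auto simp: pos_side_insert split: if_splits)
    then show "P \<in> insert h ` {Q \<in> pos_side F ` {x \<in> generic F. hval h x > 0}. R Q}"
      using x notin by auto
  next
    fix P assume "P \<in> insert h ` {Q \<in> pos_side F ` {x \<in> generic F. hval h x > 0}. R Q}"
    then obtain x where x: "x \<in> generic F" "hval h x > 0" "P = insert h (pos_side F x)"
      "R (pos_side F x)" by auto
    then have "x \<in> generic (insert h F)" "pos_side (insert h F) x = P"
      by (auto simp: generic_def pos_side_insert)
    then show "P \<in> {P \<in> patterns (insert h F). h \<in> P \<and> R (P - {h})}"
      using x(3,4) notin by (auto simp: patterns_def)
  qed
  moreover have "inj_on (insert h) {Q \<in> pos_side F ` {x \<in> generic F. hval h x > 0}. R Q}"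
    using notin by (intro inj_onI) (metis (no_types, lifting) image_iff insert_ident mem_Collect_eq)
  ultimately show "card {P \<in> patterns (insert h F). h \<in> P \<and> R (P - {h})} =
      card {Q \<in> pos_side F ` {x \<in> generic F. hval h x > 0}. R Q}"
    by (simp add: card_image)
  have "{P \<in> patterns (insert h F). h \<notin> P \<and> R P} =
      {Q \<in> pos_side F ` {x \<in> generic F. hval h x < 0}. R Q}"
  proof (intro equalityI subsetI)
    fix P assume "P \<in> {P \<in> patterns (insert h F). h \<notin> P \<and> R P}"
    then obtain x where x: "x \<in> generic F" "hval h x \<noteq> 0" "P = pos_side (insert h F) x" "h \<notin> P" "R P"
      by (auto simp: patterns_def generic_def)
    then have "hval h x < 0" "P = pos_side F x" by (auto simp: pos_side_insert split: if_splits)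
    then show "P \<in> {Q \<in> pos_side F ` {x \<in> generic F. hval h x < 0}. R Q}" using x by auto
  next
    fix P assume "P \<in> {Q \<in> pos_side F ` {x \<in> generic F. hval h x < 0}. R Q}"
    then obtain x where x: "x \<in> generic F" "hval h x < 0" "P = pos_side F x" "R P" by auto
    then have "x \<in> generic (insert h F)" "pos_side (insert h F) x = P"
      by (auto simp: generic_def pos_side_insert)
    then show "P \<in> {P \<in> patterns (insert h F). h \<notin> P \<and> R P}"
      using x(3,4) notin by (auto simp: patterns_def)
  qed
  then show "card {P \<in> patterns (insert h F). h \<notin> P \<and> R P} =
      card {Q \<in> pos_side F ` {x \<in> generic F. hval h x < 0}. R Q}" by simp
qed

lemma card_patterns_insert_sides:
  assumes "finite F" "h \<notin> F"
  shows "card (patterns (insert h F)) =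
    card (pos_side F ` {x \<in> generic F. hval h x > 0}) +
    card (pos_side F ` {x \<in> generic F. hval h x < 0})"
proof -
  have fin: "finite (patterns (insert h F))" using assms by (intro finite_patterns) auto
  have "patterns (insert h F) =
    {P \<in> patterns (insert h F). h \<in> P} \<union> {P \<in> patterns (insert h F). h \<notin> P}" by auto
  then have "card (patterns (insert h F)) =
    card {P \<in> patterns (insert h F). h \<in> P} + card {P \<in> patterns (insert h F). h \<notin> P}"
    using fin by (subst card_Un_disjoint[symmetric]) auto
  then show ?thesis using card_patterns_insert_halves[OF assms, of "\<lambda>_. True"] by simp
qed

text \<open>Inclusion-exclusion for the patterns realised on the two sides of the new hyperplane:
  the union consists of all patterns of \<open>F\<close>, and the intersection corresponds to the
  restriction.\<close>

lemma card_patterns_insert: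
  assumes "finite F" "(a, b, c) \<notin> F" "a \<noteq> b"
  shows "card (patterns (insert (a, b, c) F)) =
    card (patterns F) + card (patterns (restrict_edge (a, b, c) ` F))"
proof -
  let ?U = "pos_side F ` {x \<in> generic F. hval (a, b, c) x > 0}"
  let ?L = "pos_side F ` {x \<in> generic F. hval (a, b, c) x < 0}"
  have fin: "finite (?U \<union> ?L)"
    using patterns_split(1)[OF assms(1,3)] finite_patterns[OF assms(1)] by simp
  have "card ?U + card ?L = card (?U \<union> ?L) + card (?U \<inter> ?L)"
    using fin by (intro card_Un_Int) auto
  then show ?thesis
    using patterns_split[OF assms(1,3), of c] card_patterns_restriction[OF assms(3)]
      card_patterns_insert_sides[OF assms(1,2)] by simp
qed

section \<open>Deletion and restriction for point counts modulo q\<close>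

definition colourings :: "nat set \<Rightarrow> (nat \<times> nat \<times> int) set \<Rightarrow> int \<Rightarrow> (nat \<Rightarrow> int) set" where
  "colourings V E q =
     {x \<in> V \<rightarrow>\<^sub>E {0..<q}. \<forall>(i, j, c)\<in>E. (x i - x j - c) mod q \<noteq> 0}"

lemma finite_colourings: "finite V \<Longrightarrow> finite (colourings V E q)"
  unfolding colourings_def by (rule finite_subset[OF _ finite_PiE[of V "\<lambda>_. {0..<q}"]]) auto

lemma mod_diff_mod_diff: "(u mod q - v mod q - c) mod q = (u - v - c) mod q" for u v c q :: int
  by (metis mod_diff_left_eq mod_diff_right_eq)

text \<open>Among the points avoiding \<open>E\<close>, those on the new hyperplane modulo
  \<open>q\<close> have \<open>x a\<close> determined by \<open>x b\<close>, so deleting coordinate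
  \<open>a\<close> loses nothing. Coefficients are 1 and -1, so the modulus need not be
  prime.\<close>

lemma card_colourings_insert:
  assumes "finite V" "a \<in> V" "b \<in> V" "a \<noteq> b" "q > 0"
    and E: "E \<subseteq> V \<times> V \<times> UNIV"
  shows "card (colourings V E q) = card (colourings V (insert (a, b, c) E) q) +
    card (colourings (V - {a}) (restrict_edge (a, b, c) ` E) q)"
proof -
  let ?r = "restrict_edge (a, b, c)"
  define s where "s = (\<lambda>x::nat\<Rightarrow>int. x(a := (x b + c) mod q))"
  define Z where "Z = {x \<in> colourings V E q. (x a - x b - c) mod q = 0}"
  have key: "(s x i - s x j - d) mod q \<noteq> 0 \<longleftrightarrow> (case ?r (i, j, d) of (i', j', d') \<Rightarrow> (x i' - x j' - d') mod q \<noteq> 0)"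
    for x i j d
  proof -
    have "(s x i - s x j - d) mod q =
      ((if i = a then x b + c else x i) - (if j = a then x b + c else x j) - d) mod q"
      using mod_diff_mod_diff[of "s x i" q "s x j" d]
        mod_diff_mod_diff[of "if i = a then x b + c else x i" q "if j = a then x b + c else x j" d]
      by (auto simp: s_def)
    then show ?thesis using assms(4) by (auto simp: restrict_edge_def algebra_simps)
  qed
  have "bij_betw s (colourings (V - {a}) (?r ` E) q) Z"
  proof (rule bij_betwI[where g = "\<lambda>x. restrict x (V - {a})"])
    show "s \<in> colourings (V - {a}) (?r ` E) q \<rightarrow> Z"
    proof
      fix x assume x: "x \<in> colourings (V - {a}) (?r ` E) q"
      have "s x \<in> V \<rightarrow>\<^sub>E {0..<q}" using x assms(2,5)
        by (auto simp: colourings_def s_def PiE_iff extensional_def)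
      moreover have "\<forall>(i, j, d)\<in>E. (s x i - s x j - d) mod q \<noteq> 0"
      proof
        fix e assume e: "e \<in> E"
        obtain i j d where ijd: "e = (i, j, d)" by (cases e)
        have "case ?r (i, j, d) of (i', j', d') \<Rightarrow> (x i' - x j' - d') mod q \<noteq> 0"
          using x e ijd by (auto simp: colourings_def)
        then have "(s x i - s x j - d) mod q \<noteq> 0" unfolding key .
        then show "case e of (i, j, d) \<Rightarrow> (s x i - s x j - d) mod q \<noteq> 0" by (simp add: ijd)
      qed
      moreover have "(s x a - s x b - c) mod q = 0" using assms(4)
        by (simp add: s_def diff_diff_eq mod_diff_left_eq)
      ultimately show "s x \<in> Z" unfolding Z_def colourings_def by blast
    qed
    have sr: "s (restrict x (V - {a})) = x" if "x \<in> Z" for x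
    proof -
      have x: "x \<in> V \<rightarrow>\<^sub>E {0..<q}" "(x a - x b - c) mod q = 0"
        using that by (auto simp: Z_def colourings_def)
      have "x a = (x b + c) mod q"
      proof -
        have "x a mod q = (x b + c) mod q"
          using x(2) by (simp add: mod_eq_dvd_iff algebra_simps mod_eq_0_iff_dvd)
        moreover have "x a mod q = x a" using x(1) assms(2) by (auto simp: PiE_iff)
        ultimately show ?thesis by simp
      qed
      then show ?thesis using x(1) assms(2-4) by (auto simp: s_def fun_eq_iff PiE_iff extensional_def)
    qed
    show "(\<lambda>x. restrict x (V - {a})) \<in> Z \<rightarrow> colourings (V - {a}) (?r ` E) q"
    proof
      fix x assume x: "x \<in> Z"
      let ?y = "restrict x (V - {a})"
      have "?y \<in> V - {a} \<rightarrow>\<^sub>E {0..<q}" using x by (auto simp: Z_def colourings_def PiE_iff)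
      moreover have "case ?r e of (i, j, d) \<Rightarrow> (?y i - ?y j - d) mod q \<noteq> 0" if "e \<in> E" for e
      proof -
        obtain i j d where e: "e = (i, j, d)" by (cases e)
        have "(s ?y i - s ?y j - d) mod q \<noteq> 0"
          unfolding sr[OF x] using x that e by (auto simp: Z_def colourings_def)
        then show ?thesis unfolding key e .
      qed
      ultimately show "?y \<in> colourings (V - {a}) (?r ` E) q"
        by (auto simp: colourings_def)
    qed
    show "s (restrict x (V - {a})) = x" if "x \<in> Z" for x by (rule sr[OF that])
    show "restrict (s x) (V - {a}) = x" if "x \<in> colourings (V - {a}) (?r ` E) q" for x
      using that by (auto simp: s_def fun_eq_iff colourings_def PiE_iff extensional_def)
  qed
  then have "card (colourings (V - {a}) (?r ` E) q) = card Z" by (rule bij_betw_same_card)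
  moreover have "colourings V E q = colourings V (insert (a, b, c) E) q \<union> Z"
    "colourings V (insert (a, b, c) E) q \<inter> Z = {}"
    by (auto simp: Z_def colourings_def)
  ultimately show ?thesis using finite_colourings[OF assms(1), of E q]
    by (metis card_Un_disjoint finite_Un)
qed

text \<open>Region counts and point counts modulo \<open>q\<close> satisfy the same deletion-restriction recursion up
  to the sign of the restriction term.\<close>

lemma zaslavsky:
  assumes "finite E" "finite V" "E \<subseteq> V \<times> V \<times> UNIV"
  shows "\<exists>p :: int poly. (\<forall>\<^sub>F q in at_top. int (card (colourings V E q)) = poly p q) \<and>
    int (card (patterns E)) = (-1) ^ card V * poly p (-1)"
  using assms
proof (induction "card E" arbitrary: E V rule: less_induct)
  case less
  show ?case
  proof (cases "E = {}")
    case True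
    have "\<forall>\<^sub>F q::int in at_top. int (card (colourings V E q)) = poly (monom 1 (card V)) q"
      using eventually_gt_at_top[of 0]
      by eventually_elim (simp add: colourings_def True card_PiE less.prems poly_monom)
    moreover have "patterns E = {{}}"
      by (auto simp: True patterns_def pos_side_def generic_def)
    ultimately show ?thesis
      by (intro exI[of _ "monom 1 (card V)"]) (simp add: poly_monom flip: power_mult_distrib)
  next
    case False
    then obtain h F where hF: "E = insert h F" "h \<notin> F"
      by (metis Set.set_insert all_not_in_conv)
    obtain a b c where h: "h = (a, b, c)" by (cases h)
    have F: "finite F" "F \<subseteq> V \<times> V \<times> UNIV" and ab: "a \<in> V" "b \<in> V"
      using less.prems hF h by auto
    have card: "card F < card E" using F hF by simp
    obtain p where p: "\<forall>\<^sub>F q in at_top. int (card (colourings V F q)) = poly p q"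
      "int (card (patterns F)) = (-1) ^ card V * poly p (-1)"
      using less.hyps[OF card F(1) less.prems(2) F(2)] by blast
    \<comment> \<open>Restriction can create triples with \<open>a = b\<close>. With
      \<open>c = 0\<close> such a hyperplane is the whole space, so nothing remains; with
      \<open>c \<noteq> 0\<close> it is empty, over the reals and also modulo every \<open>q\<close>
      above \<open>\<bar>c\<bar>\<close>.\<close>
    consider "a = b" "c = 0" | "a = b" "c \<noteq> 0" | "a \<noteq> b" by blast
    then show ?thesis
    proof cases
      case 1
      then have "generic E = {}" "colourings V E q = {}" for q
        by (auto simp: hF h generic_def colourings_def)
      then show ?thesis by (intro exI[of _ 0]) (auto simp: patterns_def)
    next
      case 2
      have "\<forall>\<^sub>F q::int in at_top. int (card (colourings V E q)) = poly p q"
        using p(1) eventually_gt_at_top[of "\<bar>c\<bar>"]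
      proof eventually_elim
        case (elim q)
        have "\<not> q dvd c" using elim(2) 2(2) dvd_imp_le_int[of c q] by auto
        then have "colourings V E q = colourings V F q"
          by (auto simp: colourings_def hF h 2 mod_eq_0_iff_dvd)
        then show ?case using elim(1) by simp
      qed
      moreover have "card (patterns E) = card (patterns F)"
        unfolding patterns_def
        by (rule card_image_eq_if_kernel_eq[of "\<lambda>x. x"])
          (use 2 in \<open>auto simp: generic_def pos_side_eq_iff hF h\<close>)
      ultimately show ?thesis using p(2) by auto
    next
      case 3
      let ?F = "restrict_edge h ` F"
      have F': "?F \<subseteq> (V - {a}) \<times> (V - {a}) \<times> UNIV" "finite (V - {a})" "finite ?F"
        using F less.prems(2) ab 3 by (auto simp: restrict_edge_def h split: if_splits)
      have "card ?F < card E" using card card_image_le[OF F(1), of "restrict_edge h"] by linarith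
      then obtain p' where p':
        "\<forall>\<^sub>F q in at_top. int (card (colourings (V - {a}) ?F q)) = poly p' q"
        "int (card (patterns ?F)) = (-1) ^ card (V - {a}) * poly p' (-1)"
        using less.hyps[OF _ F'(3,2,1)] by blast
      have "\<forall>\<^sub>F q in at_top. int (card (colourings V E q)) = poly (p - p') q"
        using p(1) p'(1) eventually_gt_at_top[of 0]
      proof eventually_elim
        case (elim q)
        then show ?case
          using card_colourings_insert[OF less.prems(2) ab 3 _ F(2), of q c] by (simp add: hF h)
      qed
      \<comment> \<open>The restriction has one variable fewer, so its sign flips and the difference
        of polynomials becomes a sum of region counts at -1.\<close>
      moreover have "card V = Suc (card (V - {a}))"
        using ab(1) less.prems(2) by (metis card.remove)
      then have "int (card (patterns E)) = (-1) ^ card V * poly (p - p') (-1)"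
        using card_patterns_insert[OF F(1) hF(2)[unfolded h] 3] p(2) p'(2)
        by (simp add: hF h algebra_simps)
      ultimately show ?thesis by blast
    qed
  qed
qed

section \<open>The Shi arrangement modulo \<open>q\<close>\<close>

text \<open>Along the lexicographic order by \<open>(g i, i)\<close> the value \<open>g\<close>
  weakly increases and the rank strictly increases, so their sum strictly increases.\<close>

lemma lex_rank_less_iff:
  fixes g :: "'a::linorder \<Rightarrow> int"
  assumes "finite W"
  defines "before \<equiv> \<lambda>i. {j \<in> W. g j < g i \<or> g j = g i \<and> j < i}"
  defines "f \<equiv> \<lambda>i. g i + int (card (before i))"
  assumes "i \<in> W" "j \<in> W"
  shows "f j < f i \<longleftrightarrow> j \<in> before i"
proof -
  have mono: "f u < f v" if "u \<in> W" "u \<in> before v" for u v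
  proof -
    have "before u \<subset> before v" using that by (auto simp: before_def)
    moreover have "finite (before v)" using assms(1) by (simp add: before_def)
    ultimately have "card (before u) < card (before v)" by (rule psubset_card_mono[rotated])
    moreover have "g u \<le> g v" using that by (auto simp: before_def)
    ultimately show ?thesis by (simp add: f_def)
  qed
  have "j \<in> before i \<or> i = j \<or> i \<in> before j" using assms(4,5) by (auto simp: before_def)
  then show ?thesis using mono[OF assms(4)] mono[OF assms(5)] by (metis less_asym less_irrefl)
qed

text \<open>The Shi conditions on a line instead of a circle: labels occupy distinct positions, and
  of two neighbouring occupied positions the right one carries the larger label.\<close>

definition shi_placements :: "'a::linorder set \<Rightarrow> int \<Rightarrow> int \<Rightarrow> ('a \<Rightarrow> int) set" where
  "shi_placements W lo hi =
     {f \<in> W \<rightarrow>\<^sub>E {lo..<hi}. \<forall>i\<in>W. \<forall>j\<in>W. i < j \<longrightarrow> f i \<noteq> f j \<and> f i \<noteq> f j + 1}"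

text \<open>A placement \<open>f\<close> is encoded by the number \<open>g i\<close> of free positions before \<open>f i\<close>: labels in
  an unbroken run of occupied positions increase, so \<open>f\<close> is recovered from \<open>g\<close> by sorting the
  labels lexicographically by \<open>(g i, i)\<close>.\<close>

lemma card_shi_placements:
  fixes W :: "'a::linorder set"
  assumes W: "finite W" and size: "int (card W) \<le> hi - lo"
  shows "int (card (shi_placements W lo hi)) = (hi - lo - int (card W) + 1) ^ card W"
proof -
  let ?m = "int (card W)"
  define before where "before = (\<lambda>(g::'a \<Rightarrow> int) i. {j \<in> W. g j < g i \<or> g j = g i \<and> j < i})"
  define F where "F = (\<lambda>(g::'a \<Rightarrow> int). \<lambda>i\<in>W. g i + int (card (before g i)))"
  \<comment> \<open>On placements this is \<open>lo\<close> plus the number of free positions before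
    \<open>f i\<close>, hence one of the \<open>hi - lo - card W + 1\<close> values in
    \<open>{lo..hi - ?m}\<close>.\<close>
  define G where "G = (\<lambda>(f::'a \<Rightarrow> int). \<lambda>i\<in>W. f i - int (card {j \<in> W. f j < f i}))"
  have F_less: "F g j < F g i \<longleftrightarrow> j \<in> before g i" if "i \<in> W" "j \<in> W" for g i j
    using lex_rank_less_iff[OF W that, of g] that by (simp add: F_def before_def)
  have before_less: "card (before g i) < card W" if "i \<in> W" for g i
    using that W by (intro psubset_card_mono) (auto simp: before_def)
  have G_nonneg: "G f i \<ge> lo" "G f i \<le> hi - ?m" and G_less: "\<And>j. j \<in> W \<Longrightarrow> f j < f i \<Longrightarrow> j \<in> before (G f) i"
    if f: "f \<in> shi_placements W lo hi" and i: "i \<in> W" for f i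
  proof -
    have range: "f j \<in> {lo..<hi}" if "j \<in> W" for j using f that by (auto simp: shi_placements_def)
    have inj: "inj_on f W"
      using f by (intro inj_onI) (metis (mono_tags, lifting) linorder_neqE mem_Collect_eq shi_placements_def)
    have card_eq: "card {j \<in> W. a \<le> f j \<and> f j < b} = card (f ` {j \<in> W. a \<le> f j \<and> f j < b})" for a b
      by (rule card_image[symmetric]) (auto intro: inj_on_subset[OF inj])
    have bound: "int (card {j \<in> W. a \<le> f j \<and> f j < b}) \<le> b - a" if "a \<le> b" for a b
    proof -
      have "card (f ` {j \<in> W. a \<le> f j \<and> f j < b}) \<le> card {a..<b}" by (intro card_mono) auto
      then show ?thesis using card_eq[of a b] that by simp
    qed
    have split: "int (card {j \<in> W. f j < b}) = int (card {j \<in> W. f j < a}) + int (card {j \<in> W. a \<le> f j \<and> f j < b})"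
      if "a \<le> b" for a b
    proof -
      have "{j \<in> W. f j < b} = {j \<in> W. f j < a} \<union> {j \<in> W. a \<le> f j \<and> f j < b}" using that by auto
      moreover have "card \<dots> = card {j \<in> W. f j < a} + card {j \<in> W. a \<le> f j \<and> f j < b}"
        using W by (intro card_Un_disjoint) auto
      ultimately show ?thesis by simp
    qed
    have "{j \<in> W. f j < lo} = {}" "{j \<in> W. f j < hi} = W" using range by fastforce+
    then have "card {j \<in> W. f j < lo} = 0" "{j \<in> W. f j < hi} = W" by (simp_all only: card.empty)
    then show "G f i \<ge> lo" "G f i \<le> hi - ?m"
      using split[of lo "f i"] bound[of lo "f i"] split[of "f i" hi] bound[of "f i" hi] range[OF i] i
      by (simp_all add: G_def)
    show "j \<in> before (G f) i" if j: "j \<in> W" "f j < f i" for j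
    proof -
      have diff: "G f i - G f j = f i - f j - int (card {k \<in> W. f j \<le> f k \<and> f k < f i})"
        using split[of "f j" "f i"] i j by (simp add: G_def)
      then have "G f j \<le> G f i" using bound[of "f j" "f i"] j by simp
      moreover have "j < i" if "G f j = G f i"
      proof -
        have "card (f ` {k \<in> W. f j \<le> f k \<and> f k < f i}) = card {f j..<f i}"
          using diff that j card_eq[of "f j" "f i"] by simp
        then have full: "f ` {k \<in> W. f j \<le> f k \<and> f k < f i} = {f j..<f i}"
          by (intro card_subset_eq) auto
        \<comment> \<open>Equal free counts leave no gap between \<open>f j\<close> and
          \<open>f i\<close>. Induction on \<open>d\<close> walks along this full run, where each
          step to the right increases the label.\<close>
        have "u \<in> W \<Longrightarrow> f u = f j + 1 + int d \<Longrightarrow> f u \<le> f i \<Longrightarrow> j < u" for d u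
        proof (induction d arbitrary: u)
          case 0
          then have "\<not> u < j" "u \<noteq> j" using f j by (auto simp: shi_placements_def)
          then show ?case by simp
        next
          case (Suc d)
          then have "f u - 1 \<in> f ` {k \<in> W. f j \<le> f k \<and> f k < f i}" unfolding full by simp
          then obtain v where v: "v \<in> W" "f v = f u - 1" by auto
          then have "\<not> u < v" "u \<noteq> v" using f Suc.prems by (force simp: shi_placements_def)+
          moreover have "j < v" using Suc.IH[OF v(1)] Suc.prems v by simp
          ultimately show ?case by simp
        qed
        from this[of i "nat (f i - f j - 1)"] show ?thesis using i j by simp
      qed
      ultimately show ?thesis using j(1) by (auto simp: before_def)
    qed
  qed
  have FG: "F (G f) = f" if f: "f \<in> shi_placements W lo hi" for f
  proof
    fix i show "F (G f) i = f i"
    proof (cases "i \<in> W")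
      case True
      have "f j < f i" if "j \<in> before (G f) i" for j
      proof (rule ccontr)
        assume "\<not> f j < f i"
        moreover have "j \<in> W" "i \<noteq> j" using that by (auto simp: before_def)
        ultimately have "f i < f j" using f True by (force simp: shi_placements_def neq_iff)
        then have "i \<in> before (G f) j" using G_less[OF f \<open>j \<in> W\<close> True] by blast
        then show False using that by (auto simp: before_def)
      qed
      then have "before (G f) i = {j \<in> W. f j < f i}"
        using G_less[OF f True] by (auto simp: before_def)
      then show ?thesis using True by (simp add: F_def G_def)
    qed (use f in \<open>auto simp: F_def shi_placements_def PiE_iff extensional_def\<close>)
  qed
  have GF: "G (F g) = g" if "g \<in> W \<rightarrow>\<^sub>E {lo..hi - ?m}" for g
  proof
    fix i show "G (F g) i = g i"
    proof (cases "i \<in> W")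
      case True
      then have "{j \<in> W. F g j < F g i} = before g i" using F_less by (auto simp: before_def)
      then show ?thesis using True by (simp add: G_def F_def)
    qed (use that in \<open>auto simp: G_def PiE_iff extensional_def\<close>)
  qed
  have "bij_betw F (W \<rightarrow>\<^sub>E {lo..hi - ?m}) (shi_placements W lo hi)"
  proof (rule bij_betwI[where g = G])
    show "G \<in> shi_placements W lo hi \<rightarrow> W \<rightarrow>\<^sub>E {lo..hi - ?m}"
      using G_nonneg by (auto simp: G_def PiE_iff)
    show "F \<in> (W \<rightarrow>\<^sub>E {lo..hi - ?m}) \<rightarrow> shi_placements W lo hi"
    proof
      fix g assume g: "g \<in> W \<rightarrow>\<^sub>E {lo..hi - ?m}"
      have "F g i \<in> {lo..<hi}" if "i \<in> W" for i
      proof -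
        have "g i \<in> {lo..hi - ?m}" using g that by auto
        then show ?thesis using before_less[OF that, of g] that by (auto simp: F_def)
      qed
      moreover have "F g i \<noteq> F g j \<and> F g i \<noteq> F g j + 1" if ij: "i \<in> W" "j \<in> W" "i < j" for i j
      proof (cases "i \<in> before g j")
        case True
        then show ?thesis using F_less[OF ij(2,1), of g] by simp
      next
        case False
        \<comment> \<open>Both \<open>g\<close> and the rank are strictly larger at \<open>i\<close>
          than at \<open>j\<close>, so the positions differ by at least 2 and
          \<open>F g i = F g j + 1\<close> is excluded.\<close>
        then have less: "g j < g i" using ij by (auto simp: before_def)
        then have "before g j \<subset> before g i" using ij by (auto simp: before_def)
        then have "card (before g j) < card (before g i)"
          using W by (intro psubset_card_mono) (auto simp: before_def)
        then show ?thesis using less ij by (simp add: F_def)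
      qed
      ultimately show "F g \<in> shi_placements W lo hi"
        by (auto simp: shi_placements_def F_def)
    qed
  qed (use FG GF in auto)
  then have "card (shi_placements W lo hi) = card (W \<rightarrow>\<^sub>E {lo..hi - ?m})"
    by (rule bij_betw_same_card[symmetric])
  then show ?thesis using size by (simp add: card_PiE W) (simp add: algebra_simps)
qed

text \<open>All conditions depend only on differences, so the \<open>q\<close> translations modulo
  \<open>q\<close> act freely, and every orbit has one point with coordinate \<open>v\<close> equal
  to 0.\<close>

lemma card_colourings_base:
  assumes "v \<in> V" "q > 0" "E \<subseteq> V \<times> V \<times> UNIV"
  shows "int (card (colourings V E q)) =
    q * int (card {y \<in> colourings V E q. y v = 0})"
proof -
  define Y where "Y = {y \<in> colourings V E q. y v = 0}"
  define s where "s = (\<lambda>(t::int, y::nat\<Rightarrow>int). \<lambda>i\<in>V. (y i + t) mod q)"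
  have s_in: "s (t, y) \<in> colourings V E q" if "y \<in> colourings V E q" for t y
  proof -
    have "case e of (i, j, c) \<Rightarrow> (s (t, y) i - s (t, y) j - c) mod q \<noteq> 0" if e: "e \<in> E" for e
    proof -
      obtain i j c where ijc: "e = (i, j, c)" by (cases e)
      then have "i \<in> V" "j \<in> V" "(y i - y j - c) mod q \<noteq> 0"
        using e assms(3) \<open>y \<in> colourings V E q\<close> by (auto simp: colourings_def)
      then show ?thesis by (simp add: ijc s_def mod_diff_mod_diff)
    qed
    then show ?thesis using assms(2) by (auto simp: colourings_def s_def)
  qed
  have "bij_betw s ({0..<q} \<times> Y) (colourings V E q)"
  proof (rule bij_betwI[where g = "\<lambda>x. (x v, s (- x v, x))"])
    show "s \<in> {0..<q} \<times> Y \<rightarrow> colourings V E q" using s_in by (auto simp: Y_def)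
    show "(\<lambda>x. (x v, s (- x v, x))) \<in> colourings V E q \<rightarrow> {0..<q} \<times> Y"
    proof
      fix x assume x: "x \<in> colourings V E q"
      then have "x v \<in> {0..<q}" using assms(1) by (auto simp: colourings_def)
      moreover have "s (- x v, x) v = 0" using assms(1) by (simp add: s_def)
      ultimately show "(x v, s (- x v, x)) \<in> {0..<q} \<times> Y" using s_in[OF x] by (simp add: Y_def)
    qed
    show "(s z v, s (- s z v, s z)) = z" if "z \<in> {0..<q} \<times> Y" for z
    proof -
      obtain t y where z: "z = (t, y)" by (cases z)
      then have t: "t \<in> {0..<q}" and y: "y \<in> V \<rightarrow>\<^sub>E {0..<q}" "y v = 0"
        using that by (auto simp: Y_def colourings_def)
      have v: "s z v = t" using t y(2) assms(1) by (simp add: z s_def)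
      have "s (- t, s z) i = y i" for i
      proof (cases "i \<in> V")
        case True
        then have "y i mod q = y i" using y(1) by (auto simp: PiE_iff)
        then show ?thesis using True by (simp add: z s_def mod_diff_left_eq)
      qed (use y(1) in \<open>auto simp: s_def PiE_iff extensional_def\<close>)
      then show ?thesis using v z by auto
    qed
    show "s (x v, s (- x v, x)) = x" if "x \<in> colourings V E q" for x
    proof
      fix i
      have x: "x \<in> V \<rightarrow>\<^sub>E {0..<q}" using that by (auto simp: colourings_def)
      show "s (x v, s (- x v, x)) i = x i"
      proof (cases "i \<in> V")
        case True
        then have "x i mod q = x i" using x by (auto simp: PiE_iff)
        then show ?thesis using True by (simp add: s_def mod_add_left_eq)
      qed (use x in \<open>auto simp: s_def PiE_iff extensional_def\<close>)
    qed
  qed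
  then have "card (colourings V E q) = card ({0..<q} \<times> Y)" by (rule bij_betw_same_card[symmetric])
  then show ?thesis using assms(2) by (simp add: card_cartesian_product Y_def)
qed

section \<open>Region counts of the Shi arrangement and its restriction\<close>

definition shi_edges :: "nat \<Rightarrow> (nat \<times> nat \<times> int) set" where
  "shi_edges n = {(i, j, c). i < j \<and> j < n \<and> c \<in> {0, 1}}"

lemma finite_shi_edges: "finite (shi_edges n)"
  by (rule finite_subset[of _ "{..<n} \<times> {..<n} \<times> {0, 1}"]) (auto simp: shi_edges_def)

lemma shi_edges_subset: "shi_edges n \<subseteq> {..<n} \<times> {..<n} \<times> UNIV"
  by (auto simp: shi_edges_def)

text \<open>Pinning \<open>v\<close> at 0 cuts the circle of residues open, and the remaining labels
  form a placement on the interval that \<open>v\<close> leaves available.\<close>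

lemma card_pinned_placements:
  assumes "v \<notin> W" "0 \<le> lo" "hi \<le> q"
    and "\<And>y. y \<in> W \<rightarrow>\<^sub>E {0..<q} \<Longrightarrow>
       (\<forall>(i, j, c)\<in>E. ((y(v := 0)) i - (y(v := 0)) j - c) mod q \<noteq> 0) \<longleftrightarrow> y \<in> shi_placements W lo hi"
    and "q > 0"
  shows "card {y \<in> colourings (insert v W) E q. y v = 0} = card (shi_placements W lo hi)"
proof (rule bij_betw_same_card[OF bij_betwI[where f = "\<lambda>y. restrict y W" and g = "\<lambda>y. y(v := 0)"]])
  have upd: "(restrict y W)(v := 0) = y" if "y \<in> {y \<in> colourings (insert v W) E q. y v = 0}" for y
    using that by (auto simp: colourings_def fun_eq_iff PiE_iff extensional_def)
  show "(\<lambda>y. restrict y W) \<in> {y \<in> colourings (insert v W) E q. y v = 0} \<rightarrow> shi_placements W lo hi"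
  proof
    fix y assume y: "y \<in> {y \<in> colourings (insert v W) E q. y v = 0}"
    then have "restrict y W \<in> W \<rightarrow>\<^sub>E {0..<q}" by (auto simp: colourings_def)
    from assms(4)[OF this] show "restrict y W \<in> shi_placements W lo hi"
      unfolding upd[OF y] using y by (auto simp: colourings_def)
  qed
  show "(\<lambda>y. y(v := 0)) \<in> shi_placements W lo hi \<rightarrow> {y \<in> colourings (insert v W) E q. y v = 0}"
  proof
    fix y assume y: "y \<in> shi_placements W lo hi"
    then have "y \<in> W \<rightarrow>\<^sub>E {0..<q}" using assms(2,3) by (force simp: shi_placements_def PiE_iff)
    with assms(4)[OF this] y show "y(v := 0) \<in> {y \<in> colourings (insert v W) E q. y v = 0}"
      using assms(5) by (auto simp: colourings_def PiE_iff extensional_def)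
  qed
  show "(restrict y W)(v := 0) = y" if "y \<in> {y \<in> colourings (insert v W) E q. y v = 0}" for y
    by (rule upd[OF that])
  show "restrict (y(v := 0)) W = y" if "y \<in> shi_placements W lo hi" for y
    using that assms(1) by (auto simp: shi_placements_def fun_eq_iff PiE_iff extensional_def)
qed

text \<open>Two polynomials that agree at all large integers are equal, so the polynomial of
  \<open>zaslavsky\<close> is \<open>q * (q - n) ^ m\<close>. At -1, up to sign, it gives
  \<open>(n + 1) ^ m\<close>.\<close>

lemma card_patterns_if_colourings:
  assumes "finite E" "finite V" "E \<subseteq> V \<times> V \<times> UNIV" "card V = Suc m"
    and count: "\<forall>\<^sub>F q in at_top. int (card (colourings V E q)) = q * (q - int n) ^ m"
  shows "card (patterns E) = Suc n ^ m"
proof -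
  obtain p :: "int poly" where p: "\<forall>\<^sub>F q in at_top. int (card (colourings V E q)) = poly p q"
    "int (card (patterns E)) = (-1) ^ card V * poly p (-1)"
    using zaslavsky[OF assms(1-3)] by blast
  let ?r = "[:0, 1:] * [:- int n, 1:] ^ m"
  have "\<forall>\<^sub>F q in at_top. poly (p - ?r) q = 0"
    using p(1) count by eventually_elim simp
  then obtain N where "{N..} \<subseteq> {q. poly (p - ?r) q = 0}" by (auto simp: eventually_at_top_linorder)
  then have "infinite {q. poly (p - ?r) q = 0}" using infinite_Ici finite_subset by blast
  then have "p = ?r" using poly_roots_finite[of "p - ?r"] by auto
  then have "poly p (- 1) = - 1 * (- 1 - int n) ^ m" by (simp add: algebra_simps)
  then have "int (card (patterns E)) = (-1) ^ Suc m * (- 1 * (- 1 - int n) ^ m)"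
    using p(2) assms(4) by simp
  also have "\<dots> = (- 1) ^ m * (- 1 - int n) ^ m" by simp
  also have "\<dots> = (- 1 * (- 1 - int n)) ^ m" by (simp only: power_mult_distrib)
  also have "\<dots> = int (Suc n ^ m)" by (simp add: add.commute)
  finally show ?thesis by linarith
qed

text \<open>The range is the one reached by differences of two representatives in
  \<open>{0..<q}\<close> shifted by at most 1, endpoints included.\<close>

lemma mod_eq_0_iff_small:
  fixes d q :: int
  assumes "q > 0" "- q \<le> d" "d \<le> q"
  shows "d mod q = 0 \<longleftrightarrow> d = 0 \<or> d = q \<or> d = - q"
proof -
  have "d = 0 \<or> d = q \<or> d = - q" if dvd: "q dvd d"
  proof -
    obtain k where k: "d = q * k" using dvd by blast
    then have "q * - 1 \<le> q * k" "q * k \<le> q * 1" using assms by simp_all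
    then have "- 1 \<le> k" "k \<le> 1" by (simp_all only: mult_le_cancel_left_pos[OF assms(1)])
    then have "k = - 1 \<or> k = 0 \<or> k = 1" by linarith
    then show ?thesis using k by auto
  qed
  then show ?thesis by (auto simp: mod_eq_0_iff_dvd)
qed

lemma card_patterns_shi:
  assumes "n \<ge> 1"
  shows "card (patterns (shi_edges n)) = Suc n ^ (n - 1)"
proof (rule card_patterns_if_colourings[OF finite_shi_edges _ shi_edges_subset])
  show "card {..<n} = Suc (n - 1)" using assms by simp
  show "\<forall>\<^sub>F q in at_top. int (card (colourings {..<n} (shi_edges n) q)) = q * (q - int n) ^ (n - 1)"
    using eventually_ge_at_top[of "int n + 3"]
  proof eventually_elim
    case (elim q)
    let ?W = "{1..<n}"
    have V: "{..<n} = insert 0 ?W" using assms by auto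
    have "card {y \<in> colourings (insert 0 ?W) (shi_edges n) q. y 0 = 0} = card (shi_placements ?W 1 (q - 1))"
    proof (rule card_pinned_placements)
      fix y assume y: "y \<in> ?W \<rightarrow>\<^sub>E {0..<q}"
      let ?z = "y(0 := 0)"
      define ok where "ok = (\<lambda>i j c. (?z i - ?z j - c) mod q \<noteq> 0)"
      have y_range: "0 \<le> y i" "y i < q" if "i \<in> ?W" for i using y that by (auto simp: PiE_iff)
      \<comment> \<open>With coordinate 0 pinned at 0, the residues 0 and -1 are forbidden. The
        \<open>q - 2\<close> remaining positions and \<open>n - 1\<close> labels give the base
        \<open>q - 2 - (n - 1) + 1 = q - n\<close>; inside this interval no difference can wrap
        around.\<close>
      have first: "ok 0 j 0 \<and> ok 0 j 1 \<longleftrightarrow> y j \<in> {1..<q - 1}" if "j \<in> ?W" for j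
        using that y_range[OF that] elim by (auto simp: ok_def mod_eq_0_iff_small)
      have other: "ok i j 0 \<and> ok i j 1 \<longleftrightarrow> y i \<noteq> y j \<and> y i \<noteq> y j + 1"
        if "i \<in> ?W" "j \<in> ?W" "y i \<in> {1..<q - 1}" "y j \<in> {1..<q - 1}" for i j
        using that elim by (auto simp: ok_def mod_eq_0_iff_small)
      have "(\<forall>(i, j, c)\<in>shi_edges n. ok i j c) \<longleftrightarrow>
          (\<forall>j\<in>?W. ok 0 j 0 \<and> ok 0 j 1) \<and> (\<forall>i\<in>?W. \<forall>j\<in>?W. i < j \<longrightarrow> ok i j 0 \<and> ok i j 1)"
        (is "?lhs \<longleftrightarrow> ?rhs")
      proof
        show "?lhs \<Longrightarrow> ?rhs" by (auto simp: shi_edges_def)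
        assume ?rhs
        show ?lhs
        proof clarify
          fix i j c assume "(i, j, c) \<in> shi_edges n"
          then show "ok i j c" using \<open>?rhs\<close> by (cases "i = 0") (auto simp: shi_edges_def)
        qed
      qed
      also have "\<dots> \<longleftrightarrow> (\<forall>j\<in>?W. y j \<in> {1..<q - 1}) \<and>
          (\<forall>i\<in>?W. \<forall>j\<in>?W. i < j \<longrightarrow> y i \<noteq> y j \<and> y i \<noteq> y j + 1)"
      proof (rule conj_cong)
        assume "\<forall>j\<in>?W. y j \<in> {1..<q - 1}"
        then show "(\<forall>i\<in>?W. \<forall>j\<in>?W. i < j \<longrightarrow> ok i j 0 \<and> ok i j 1) \<longleftrightarrow>
            (\<forall>i\<in>?W. \<forall>j\<in>?W. i < j \<longrightarrow> y i \<noteq> y j \<and> y i \<noteq> y j + 1)"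
          using other by blast
      qed (use first in blast)
      also have "\<dots> \<longleftrightarrow> y \<in> shi_placements ?W 1 (q - 1)"
        using y by (auto simp: shi_placements_def PiE_iff)
      finally show "(\<forall>(i, j, c)\<in>shi_edges n. (?z i - ?z j - c) mod q \<noteq> 0) \<longleftrightarrow>
          y \<in> shi_placements ?W 1 (q - 1)"
        unfolding ok_def .
    qed (use elim in auto)
    moreover have "int (card (shi_placements ?W 1 (q - 1))) = (q - int n) ^ (n - 1)"
      using elim assms by (subst card_shi_placements) (auto simp: of_nat_diff algebra_simps)
    moreover have "int (card (colourings {..<n} (shi_edges n) q)) =
        q * int (card {y \<in> colourings {..<n} (shi_edges n) q. y 0 = 0})"
      using elim assms shi_edges_subset by (intro card_colourings_base) auto
    ultimately show ?case unfolding V by simp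
  qed
qed simp

definition shi_restriction :: "nat \<Rightarrow> (nat \<times> nat \<times> int) set" where
  "shi_restriction n = restrict_edge (0, 1, 1) ` (shi_edges n - {(0, 1, 1)})"

text \<open>Substituting \<open>x 0 = x 1 + 1\<close> turns \<open>(0, j, c)\<close> into
  \<open>(1, j, c - 1)\<close>. The triples \<open>(0, j, 1)\<close> and \<open>(1, j, 0)\<close>
  with \<open>j \<ge> 2\<close> therefore coincide, and \<open>(0, 1, 0)\<close> becomes the empty
  hyperplane \<open>(1, 1, - 1)\<close>.\<close>

lemma shi_restriction_eq:
  assumes "n \<ge> 2"
  shows "shi_restriction n = {(1, 1, - 1)} \<union> {1} \<times> {2..<n} \<times> {- 1, 0, 1} \<union>
    {(i, j, c). 2 \<le> i \<and> i < j \<and> j < n \<and> c \<in> {0, 1}}" (is "_ = ?R")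
proof
  show "shi_restriction n \<subseteq> ?R"
    by (auto simp: shi_restriction_def shi_edges_def restrict_edge_def split: if_splits)
  have im: "e \<in> shi_restriction n" if "d \<in> shi_edges n - {(0, 1, 1)}" "restrict_edge (0, 1, 1) d = e" for d e
    using that by (auto simp: shi_restriction_def)
  show "?R \<subseteq> shi_restriction n"
  proof
    fix e assume "e \<in> ?R"
    then consider "e = (1, 1, - 1)" | j where "2 \<le> j" "j < n" "e = (1, j, -1)"
      | j where "2 \<le> j" "j < n" "e = (1, j, 0)"  | j where "2 \<le> j" "j < n" "e = (1, j, 1)"
      | i j c where "2 \<le> i" "i < j" "j < n" "c \<in> {0, 1}" "e = (i, j, c)"
      by auto
    then show "e \<in> shi_restriction n"
    proof cases
      case 1 then show ?thesis using assms
        by (intro im[of "(0, 1, 0)"]) (auto simp: shi_edges_def restrict_edge_def)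
    next
      case (2 j) then show ?thesis
        by (intro im[of "(0, j, 0)"]) (auto simp: shi_edges_def restrict_edge_def)
    next
      case (3 j) then show ?thesis
        by (intro im[of "(1, j, 0)"]) (auto simp: shi_edges_def restrict_edge_def)
    next
      case (4 j) then show ?thesis
        by (intro im[of "(1, j, 1)"]) (auto simp: shi_edges_def restrict_edge_def)
    next
      case 5 then show ?thesis
        by (intro im[of e]) (auto simp: shi_edges_def restrict_edge_def)
    qed
  qed
qed

lemma card_patterns_shi_restriction:
  assumes "n \<ge> 2"
  shows "card (patterns (shi_restriction n)) = Suc n ^ (n - 2)"
proof (rule card_patterns_if_colourings)
  show "finite (shi_restriction n)" using finite_shi_edges by (simp add: shi_restriction_def)
  show sub: "shi_restriction n \<subseteq> {1..<n} \<times> {1..<n} \<times> UNIV"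
    using assms by (auto simp: shi_restriction_eq)
  show "card {1..<n} = Suc (n - 2)" using assms by simp
  show "\<forall>\<^sub>F q in at_top. int (card (colourings {1..<n} (shi_restriction n) q)) = q * (q - int n) ^ (n - 2)"
    using eventually_ge_at_top[of "int n + 3"]
  proof eventually_elim
    case (elim q)
    let ?W = "{2..<n}"
    have V: "{1..<n} = insert 1 ?W" using assms by auto
    have "card {y \<in> colourings (insert 1 ?W) (shi_restriction n) q. y 1 = 0} =
        card (shi_placements ?W 2 (q - 1))"
    proof (rule card_pinned_placements)
      fix y assume y: "y \<in> ?W \<rightarrow>\<^sub>E {0..<q}"
      let ?z = "y(1 := 0)"
      define ok where "ok = (\<lambda>i j c. (?z i - ?z j - c) mod q \<noteq> 0)"
      have y_range: "0 \<le> y i" "y i < q" if "i \<in> ?W" for i using y that by (auto simp: PiE_iff)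
      \<comment> \<open>Now the residues 0, 1 and -1 are forbidden, but one label fewer is placed:
        \<open>q - 3 - (n - 2) + 1\<close> is again \<open>q - n\<close>.\<close>
      have first: "ok 1 j (- 1) \<and> ok 1 j 0 \<and> ok 1 j 1 \<longleftrightarrow> y j \<in> {2..<q - 1}" if "j \<in> ?W" for j
        using that y_range[OF that] elim by (auto simp: ok_def mod_eq_0_iff_small)
      have other: "ok i j 0 \<and> ok i j 1 \<longleftrightarrow> y i \<noteq> y j \<and> y i \<noteq> y j + 1"
        if "i \<in> ?W" "j \<in> ?W" "y i \<in> {2..<q - 1}" "y j \<in> {2..<q - 1}" for i j
        using that elim by (auto simp: ok_def mod_eq_0_iff_small)
      have ok11: "ok 1 1 (- 1)" using elim by (simp add: ok_def mod_eq_0_iff_small)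
      have "(\<forall>(i, j, c)\<in>shi_restriction n. ok i j c) \<longleftrightarrow>
          (\<forall>j\<in>?W. ok 1 j (- 1) \<and> ok 1 j 0 \<and> ok 1 j 1) \<and>
          (\<forall>i\<in>?W. \<forall>j\<in>?W. i < j \<longrightarrow> ok i j 0 \<and> ok i j 1)" (is "?lhs \<longleftrightarrow> ?rhs")
      proof
        assume ?lhs
        then have "ok i j c" if "(i, j, c) \<in> shi_restriction n" for i j c using that by blast
        then show ?rhs by (simp add: shi_restriction_eq[OF assms])
      next
        assume ?rhs
        show ?lhs
        proof clarify
          fix i j c assume "(i, j, c) \<in> shi_restriction n"
          then show "ok i j c" using \<open>?rhs\<close> ok11 by (auto simp: shi_restriction_eq[OF assms])
        qed
      qed
      also have "\<dots> \<longleftrightarrow> (\<forall>j\<in>?W. y j \<in> {2..<q - 1}) \<and>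
          (\<forall>i\<in>?W. \<forall>j\<in>?W. i < j \<longrightarrow> y i \<noteq> y j \<and> y i \<noteq> y j + 1)"
      proof (rule conj_cong)
        assume "\<forall>j\<in>?W. y j \<in> {2..<q - 1}"
        then show "(\<forall>i\<in>?W. \<forall>j\<in>?W. i < j \<longrightarrow> ok i j 0 \<and> ok i j 1) \<longleftrightarrow>
            (\<forall>i\<in>?W. \<forall>j\<in>?W. i < j \<longrightarrow> y i \<noteq> y j \<and> y i \<noteq> y j + 1)"
          using other by blast
      qed (use first in blast)
      also have "\<dots> \<longleftrightarrow> y \<in> shi_placements ?W 2 (q - 1)"
        using y by (auto simp: shi_placements_def PiE_iff)
      finally show "(\<forall>(i, j, c)\<in>shi_restriction n. (?z i - ?z j - c) mod q \<noteq> 0) \<longleftrightarrow>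
          y \<in> shi_placements ?W 2 (q - 1)"
        unfolding ok_def .
    qed (use elim in auto)
    moreover have "int (card (shi_placements ?W 2 (q - 1))) = (q - int n) ^ (n - 2)"
      using elim assms by (subst card_shi_placements) (auto simp: of_nat_diff algebra_simps)
    moreover have "int (card (colourings {1..<n} (shi_restriction n) q)) =
        q * int (card {y \<in> colourings {1..<n} (shi_restriction n) q. y 1 = 0})"
      using elim assms sub by (intro card_colourings_base) auto
    ultimately show ?case unfolding V by simp
  qed
qed simp

section \<open>Comparing the three families of Shi regions\<close>

lemma shi_patterns_by_first_difference:
  assumes "n \<ge> 2"
  defines "E \<equiv> shi_edges n"
  defines "neg \<equiv> card {P \<in> patterns E. (0, 1, 0) \<notin> P}"
    and "mid \<equiv> card {P \<in> patterns E. (0, 1, 0) \<in> P \<and> (0, 1, 1) \<notin> P}"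
    and "upper \<equiv> card {P \<in> patterns E. (0, 1, 1) \<in> P}"
  shows "2 * neg + Suc n ^ (n - 2) = Suc n ^ (n - 1)"
    and "neg + mid + upper = Suc n ^ (n - 1)"
    and "mid \<le> neg" "upper \<le> neg"
proof -
  define h h0 F where "h = (0::nat, 1::nat, 1::int)" and "h0 = (0::nat, 1::nat, 0::int)" and "F = E - {h}"
  have E: "E = insert h F" "h \<notin> F" and F: "finite F" "h0 \<in> F"
    using assms(1) finite_shi_edges by (auto simp: F_def h_def h0_def E_def shi_edges_def)
  let ?U = "pos_side F ` {x \<in> generic F. hval h x > 0}"
  let ?L = "pos_side F ` {x \<in> generic F. hval h x < 0}"
  let ?A = "{Q \<in> patterns F. h0 \<in> Q}" and ?B = "{Q \<in> patterns F. h0 \<notin> Q}"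
  have UL: "?U \<union> ?L = patterns F" unfolding h_def by (rule patterns_split(1)[OF F(1)]) simp
  have finP: "finite (patterns F)" "finite (patterns E)"
    using F(1) finite_shi_edges by (auto intro: finite_patterns simp: E_def)
  \<comment> \<open>A difference above 1 is positive, so the positive side of \<open>h\<close> lies
    inside that of \<open>h0\<close>.\<close>
  have UA: "?U \<subseteq> ?A" using UL F(2) by (auto simp: pos_side_def h_def h0_def)
  have h_h0: "h0 \<in> P" if "P \<in> patterns E" "h \<in> P" for P
    using that F(2) E by (auto simp: patterns_def pos_side_def h_def h0_def)
  have "upper = card {P \<in> patterns (insert h F). h \<in> P}" by (simp only: upper_def E(1) h_def)
  then have "upper = card ?U"
    using card_patterns_insert_halves(1)[OF F(1) E(2), of "\<lambda>_. True"] by simp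
  then have upper_le: "upper \<le> card ?A" using UA finP by (simp add: card_mono)
  have "{P \<in> patterns E. (0, 1, 0) \<in> P \<and> (0, 1, 1) \<notin> P} = {P \<in> patterns (insert h F). h \<notin> P \<and> h0 \<in> P}"
    by (auto simp: E(1) h_def h0_def)
  then have "mid = card {Q \<in> ?L. h0 \<in> Q}"
    using card_patterns_insert_halves(2)[OF F(1) E(2), of "\<lambda>P. h0 \<in> P"] by (simp add: mid_def)
  moreover have "{Q \<in> ?L. h0 \<in> Q} \<subseteq> ?A" using UL by auto
  ultimately have mid_le: "mid \<le> card ?A" using finP by (simp add: card_mono)
  have "{P \<in> patterns E. (0, 1, 0) \<notin> P} = {P \<in> patterns (insert h F). h \<notin> P \<and> h0 \<notin> P}"
    using h_h0 by (auto simp: E(1) h0_def)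
  then have "neg = card {Q \<in> ?L. h0 \<notin> Q}"
    using card_patterns_insert_halves(2)[OF F(1) E(2), of "\<lambda>P. h0 \<notin> P"] by (simp add: neg_def)
  \<comment> \<open>The hyperplane \<open>h\<close> does not cut the cells on the negative side of
    \<open>h0\<close>, so adding it leaves their number unchanged.\<close>
  moreover have "{Q \<in> ?L. h0 \<notin> Q} = ?B" using UA unfolding UL[symmetric] by blast
  ultimately have neg_B: "neg = card ?B" by simp
  have "card ?A = card ?B"
  proof -
    define s where "s = (\<lambda>x::nat \<Rightarrow> real. x \<circ> Transposition.transpose 0 1)"
    have ss: "s (s x) = x" for x by (simp add: s_def fun_eq_iff)
    have s_h0: "hval h0 (s x) = - hval h0 x" for x by (simp add: s_def h0_def)
    \<comment> \<open>Apart from \<open>h\<close> and \<open>h0\<close>, every edge has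
      \<open>j \<ge> 2\<close>. The swap fixes that index and at most exchanges the first indices 0
      and 1, whose edges to \<open>j\<close> carry the same constants.\<close>
    have s_F: "\<exists>e'\<in>F - {h0}. \<forall>x. hval e (s x) = hval e' x" if e: "e \<in> F - {h0}" for e
    proof -
      obtain i j c where ijc: "e = (i, j, c)" by (cases e)
      have j: "j \<ge> 2" "i < j" "j < n" "c \<in> {0, 1}"
        using e by (cases "j = 0"; cases "j = 1"; auto simp: ijc F_def E_def h_def h0_def shi_edges_def)+
      then have "(Transposition.transpose 0 1 i, j, c) \<in> F - {h0}"
        by (auto simp: F_def E_def h_def h0_def shi_edges_def Transposition.transpose_def)
      then show ?thesis by (rule rev_bexI) (use j in \<open>simp add: ijc s_def\<close>)
    qed
    have s_gen: "s x \<in> generic F" if "x \<in> generic F" for x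
    proof -
      have "hval e (s x) \<noteq> 0" if "e \<in> F" for e
        using s_F[of e] s_h0[of x] \<open>x \<in> generic F\<close> F(2) that by (cases "e = h0") (auto simp: generic_def)
      then show ?thesis by (simp add: generic_def)
    qed
    have s_pat: "pos_side F (s x) = pos_side F (s y)"
      if "x \<in> generic F" "y \<in> generic F" "pos_side F x = pos_side F y" for x y
    proof -
      have "hval e (s x) > 0 \<longleftrightarrow> hval e (s y) > 0" if e: "e \<in> F" for e
      proof (cases "e = h0")
        case True
        have "hval h0 x \<noteq> 0" "hval h0 y \<noteq> 0" "hval h0 x > 0 \<longleftrightarrow> hval h0 y > 0"
          using \<open>x \<in> generic F\<close> \<open>y \<in> generic F\<close> \<open>pos_side F x = pos_side F y\<close> F(2)
          by (auto simp: generic_def pos_side_eq_iff)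
        then show ?thesis unfolding True s_h0 by linarith
      next
        case False
        then show ?thesis using s_F[of e] e \<open>pos_side F x = pos_side F y\<close>
          by (auto simp: pos_side_eq_iff)
      qed
      then show ?thesis by (simp add: pos_side_eq_iff)
    qed
    have side: "h0 \<in> pos_side F x \<longleftrightarrow> hval h0 x > 0" "h0 \<notin> pos_side F x \<longleftrightarrow> hval h0 x < 0"
      if "x \<in> generic F" for x
    proof -
      have "hval h0 x \<noteq> 0" using that F(2) by (simp add: generic_def)
      then show "h0 \<in> pos_side F x \<longleftrightarrow> hval h0 x > 0" "h0 \<notin> pos_side F x \<longleftrightarrow> hval h0 x < 0"
        using F(2) by (auto simp: pos_side_def)
    qed
    have "?A = pos_side F ` {x \<in> generic F. hval h0 x > 0}"
      unfolding patterns_def using side(1) by blast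
    moreover have "?B = pos_side F ` {x \<in> generic F. hval h0 x < 0}"
      unfolding patterns_def using side(2) by blast
    moreover have "s ` {x \<in> generic F. hval h0 x > 0} = {x \<in> generic F. hval h0 x < 0}"
    proof
      show "{x \<in> generic F. hval h0 x < 0} \<subseteq> s ` {x \<in> generic F. hval h0 x > 0}"
      proof
        fix x assume "x \<in> {x \<in> generic F. hval h0 x < 0}"
        then show "x \<in> s ` {x \<in> generic F. hval h0 x > 0}"
          using s_gen[of x] s_h0[of x] ss[of x] by (intro image_eqI[of _ _ "s x"]) auto
      qed
    qed (use s_gen s_h0 in auto)
    then have "card (pos_side F ` {x \<in> generic F. hval h0 x > 0}) =
        card (pos_side F ` {x \<in> generic F. hval h0 x < 0})"
    proof (rule card_image_eq_if_kernel_eq)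
      fix x y assume "x \<in> {x \<in> generic F. hval h0 x > 0}" "y \<in> {x \<in> generic F. hval h0 x > 0}"
      then show "pos_side F x = pos_side F y \<longleftrightarrow> pos_side F (s x) = pos_side F (s y)"
        using s_pat[of x y] s_pat[of "s x" "s y"] s_gen[of x] s_gen[of y] ss by auto
    qed
    ultimately show ?thesis by simp
  qed
  then show "mid \<le> neg" "upper \<le> neg" using mid_le upper_le neg_B by simp_all
  have "patterns F = ?A \<union> ?B" by auto
  then have "card (patterns F) = card ?A + card ?B"
    using finP(1) by (subst card_Un_disjoint[symmetric]) auto
  then have F_neg: "card (patterns F) = 2 * neg" using \<open>card ?A = card ?B\<close> neg_B by simp
  have total: "card (patterns E) = Suc n ^ (n - 1)" unfolding E_def using assms(1) by (intro card_patterns_shi) simp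
  have "card (patterns (insert (0, 1, 1) F)) = card (patterns F) + card (patterns (restrict_edge (0, 1, 1) ` F))"
    using F(1) E(2) by (intro card_patterns_insert) (auto simp: h_def)
  moreover have "restrict_edge (0, 1, 1) ` F = shi_restriction n"
    by (simp add: shi_restriction_def F_def E_def h_def)
  ultimately show "2 * neg + Suc n ^ (n - 2) = Suc n ^ (n - 1)"
    using total F_neg card_patterns_shi_restriction[OF assms(1)] E(1) by (simp add: h_def)
  let ?N = "{P \<in> patterns E. (0, 1, 0) \<notin> P}" and ?M = "{P \<in> patterns E. (0, 1, 0) \<in> P \<and> (0, 1, 1) \<notin> P}"
  let ?O = "{P \<in> patterns E. (0, 1, 1) \<in> P}"
  have "patterns E = ?N \<union> (?M \<union> ?O)" by auto
  moreover have "?M \<inter> ?O = {}" "?N \<inter> (?M \<union> ?O) = {}" using h_h0 by (auto simp: h_def h0_def)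
  moreover have "finite ?N" "finite ?M" "finite ?O" using finP by auto
  ultimately have "card (patterns E) = neg + mid + upper"
    unfolding neg_def mid_def upper_def by (metis (no_types, lifting) add.assoc card_Un_disjoint finite_UnI)
  then show "neg + mid + upper = Suc n ^ (n - 1)" using total by simp
qed

section \<open>Regions as sign patterns\<close>

text \<open>A component cannot leave a clopen set that it meets, and the second assumption puts each
  of these sets inside a single component.\<close>

lemma connected_components_of_clopen_partition:
  assumes "\<And>x. x \<in> topspace X \<Longrightarrow> x \<in> K (k x)"
    and "\<And>x y. x \<in> topspace X \<Longrightarrow> y \<in> topspace X \<Longrightarrow> y \<in> K (k x) \<Longrightarrow> connected_component_of X x y"
    and "\<And>x. x \<in> topspace X \<Longrightarrow> openin X (K (k x))"
    and "\<And>x. x \<in> topspace X \<Longrightarrow> closedin X (K (k x))"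
  shows "connected_components_of X = (\<lambda>x. K (k x)) ` topspace X"
proof -
  have "connected_component_of_set X x = K (k x)" if x: "x \<in> topspace X" for x
  proof
    have "\<not> disjnt (connected_component_of_set X x) (K (k x))"
      using assms(1)[OF x] x by (auto simp: disjnt_iff connected_component_of_refl intro: exI[of _ x])
    then show "connected_component_of_set X x \<subseteq> K (k x)"
      using connectedin_clopen_cases[OF connectedin_connected_component_of[of X x] assms(4)[OF x] assms(3)[OF x]] by blast
    show "K (k x) \<subseteq> connected_component_of_set X x"
      using assms(2)[OF x] openin_subset[OF assms(3)[OF x]] by auto
  qed
  then show ?thesis by (auto simp: connected_components_of_def)
qed

lemma continuous_on_hval: "continuous_on A (hval e)"
  by (cases e) (auto simp: hval_def intro!: continuous_intros continuous_on_product_then_coordinatewise[OF continuous_on_id])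

text \<open>Generic points may have arbitrary coordinates from \<open>n\<close> on; setting these to
  0 gives points of \<open>Euclidean_space n\<close>.\<close>

definition shi_complement :: "nat \<Rightarrow> (nat \<Rightarrow> real) set" where
  "shi_complement n = {x \<in> generic (shi_edges n). \<forall>i\<ge>n. x i = 0}"

definition shi_cell :: "nat \<Rightarrow> (nat \<times> nat \<times> int) set \<Rightarrow> (nat \<Rightarrow> real) set" where
  "shi_cell n P = {x \<in> shi_complement n. pos_side (shi_edges n) x = P}"

text \<open>No \<open>hval\<close> of an edge vanishes on the complement, so the strict and the weak
  inequalities cut out the same cell: the former show it open, the latter closed.\<close>

lemma shi_cell_clopen:
  assumes "P \<subseteq> shi_edges n"
  shows "openin (top_of_set (shi_complement n)) (shi_cell n P)"
    and "closedin (top_of_set (shi_complement n)) (shi_cell n P)"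
proof -
  let ?E = "shi_edges n"
  have pos: "open {x. hval e x > 0}" "closed {x. hval e x \<ge> 0}" for e
    by (intro open_Collect_less closed_Collect_le continuous_on_hval continuous_intros)+
  have neg: "open {x. hval e x < 0}" "closed {x. hval e x \<le> 0}" for e
    by (intro open_Collect_less closed_Collect_le continuous_on_hval continuous_intros)+
  have mem: "x \<in> shi_cell n P \<longleftrightarrow> x \<in> shi_complement n \<and> (\<forall>e\<in>?E. e \<in> P \<longleftrightarrow> hval e x > 0)" for x
    using assms by (auto simp: shi_cell_def pos_side_def)
  have nonzero: "hval e x \<noteq> 0" if "x \<in> shi_complement n" "e \<in> ?E" for e x
    using that by (simp add: shi_complement_def generic_def)
  have "shi_cell n P = shi_complement n \<inter> (\<Inter>e\<in>?E. if e \<in> P then {x. hval e x > 0} else {x. hval e x < 0})"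
  proof (intro set_eqI)
    fix x
    have "(e \<in> P \<longleftrightarrow> hval e x > 0) \<longleftrightarrow> x \<in> (if e \<in> P then {x. hval e x > 0} else {x. hval e x < 0})"
      if "x \<in> shi_complement n" "e \<in> ?E" for e
      using nonzero[OF that] by auto
    then show "x \<in> shi_cell n P \<longleftrightarrow>
        x \<in> shi_complement n \<inter> (\<Inter>e\<in>?E. if e \<in> P then {x. hval e x > 0} else {x. hval e x < 0})"
      unfolding mem Int_iff INT_iff by blast
  qed
  moreover have "open (\<Inter>e\<in>?E. if e \<in> P then {x. hval e x > 0} else {x. hval e x < 0})"
    using pos neg finite_shi_edges by (intro open_INT) auto
  ultimately show "openin (top_of_set (shi_complement n)) (shi_cell n P)" by (auto simp: openin_open)
  have "shi_cell n P = shi_complement n \<inter> (\<Inter>e\<in>?E. if e \<in> P then {x. hval e x \<ge> 0} else {x. hval e x \<le> 0})"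
  proof (intro set_eqI)
    fix x
    have "(e \<in> P \<longleftrightarrow> hval e x > 0) \<longleftrightarrow> x \<in> (if e \<in> P then {x. hval e x \<ge> 0} else {x. hval e x \<le> 0})"
      if "x \<in> shi_complement n" "e \<in> ?E" for e
      using nonzero[OF that] by auto
    then show "x \<in> shi_cell n P \<longleftrightarrow>
        x \<in> shi_complement n \<inter> (\<Inter>e\<in>?E. if e \<in> P then {x. hval e x \<ge> 0} else {x. hval e x \<le> 0})"
      unfolding mem Int_iff INT_iff by blast
  qed
  moreover have "closed (\<Inter>e\<in>?E. if e \<in> P then {x. hval e x \<ge> 0} else {x. hval e x \<le> 0})"
    using pos neg by (intro closed_INT) auto
  ultimately show "closedin (top_of_set (shi_complement n)) (shi_cell n P)" by (auto simp: closedin_closed)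
qed

lemma connected_component_shi_cell:
  assumes "x \<in> shi_cell n P" "y \<in> shi_cell n P"
  shows "connected_component_of (top_of_set (shi_complement n)) x y"
proof -
  let ?T = "(\<lambda>t i. (1 - t) * x i + t * y i) ` {0..1::real}"
  have "connected ?T"
    by (intro connected_continuous_image continuous_on_coordinatewise_then_product continuous_intros) simp
  moreover have "?T \<subseteq> shi_complement n"
  proof
    fix z assume "z \<in> ?T"
    then obtain t where "t \<in> {0..1}" "z = (\<lambda>i. (1 - t) * x i + t * y i)" by auto
    then show "z \<in> shi_complement n"
      using assms pos_side_segment(1)[of x "shi_edges n" y t] by (auto simp: shi_cell_def shi_complement_def)
  qed
  moreover have "x \<in> ?T" by (intro image_eqI[of _ _ 0]) auto
  moreover have "y \<in> ?T" by (intro image_eqI[of _ _ 1]) auto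
  ultimately show ?thesis
    unfolding connected_component_of_def by (intro exI[of _ ?T]) (simp add: connectedin_subtopology)
qed

lemma shi_cell_nonempty:
  assumes "P \<in> patterns (shi_edges n)"
  shows "shi_cell n P \<noteq> {}"
proof -
  obtain x where x: "x \<in> generic (shi_edges n)" "P = pos_side (shi_edges n) x"
    using assms by (auto simp: patterns_def)
  define y where "y = (\<lambda>i. if i < n then x i else 0)"
  have "hval e y = hval e x" if "e \<in> shi_edges n" for e
    using that by (auto simp: y_def shi_edges_def)
  then have "y \<in> shi_cell n P"
    using x by (auto simp: shi_cell_def shi_complement_def generic_def pos_side_def y_def)
  then show ?thesis by auto
qed

text \<open>The nonempty cells partition the complement; they are clopen in it and connected by
  segments, hence they are its components.\<close>

lemma shi_regions_eq: "shi_regions n = shi_cell n ` patterns (shi_edges n)"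
proof -
  let ?E = "shi_edges n" and ?X = "top_of_set (shi_complement n)"
  have "topspace (Euclidean_space n) - \<Union>(shi_arrangement n) = shi_complement n"
  proof (intro equalityI subsetI)
    fix x assume x: "x \<in> topspace (Euclidean_space n) - \<Union>(shi_arrangement n)"
    have "hval e x \<noteq> 0" if e: "e \<in> ?E" for e
    proof -
      obtain i j c where ijc: "e = (i, j, c)" "i < j" "j < n" "c \<in> {0, 1}"
        using e by (auto simp: shi_edges_def)
      then have "{y \<in> topspace (Euclidean_space n). y i - y j = of_int c} \<in> shi_arrangement n"
        unfolding shi_arrangement_def by (intro CollectI exI[of _ i] exI[of _ j] exI[of _ "of_int c"]) auto
      then show ?thesis using x ijc(1) by auto
    qed
    then show "x \<in> shi_complement n"
      using x by (auto simp: shi_complement_def generic_def topspace_Euclidean_space)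
  next
    fix x assume x: "x \<in> shi_complement n"
    have "x i - x j \<noteq> c" if "i < j" "j < n" "c \<in> {0, 1}" for i j and c :: real
    proof -
      have "hval (i, j, 0) x \<noteq> 0" "hval (i, j, 1) x \<noteq> 0"
        using x that by (auto simp: shi_complement_def generic_def shi_edges_def simp del: hval_simp)
      then show ?thesis using that(3) by auto
    qed
    then show "x \<in> topspace (Euclidean_space n) - \<Union>(shi_arrangement n)"
      using x unfolding shi_arrangement_def by (auto simp: topspace_Euclidean_space shi_complement_def)
  qed
  moreover have "{x. \<forall>i\<ge>n. x i = 0} \<inter> shi_complement n = shi_complement n"
    by (auto simp: shi_complement_def)
  ultimately have X: "subtopology (Euclidean_space n) (topspace (Euclidean_space n) - \<Union>(shi_arrangement n)) = ?X"
    by (simp only: Euclidean_space_def subtopology_subtopology euclidean_product_topology)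
  have "connected_components_of ?X = (\<lambda>x. shi_cell n (pos_side ?E x)) ` topspace ?X"
  proof (rule connected_components_of_clopen_partition)
    fix x assume "x \<in> topspace ?X"
    then show x: "x \<in> shi_cell n (pos_side ?E x)" by (simp add: shi_cell_def)
    have "pos_side ?E x \<subseteq> ?E" by (auto simp: pos_side_def)
    then show "openin ?X (shi_cell n (pos_side ?E x))" "closedin ?X (shi_cell n (pos_side ?E x))"
      by (rule shi_cell_clopen)+
    show "connected_component_of ?X x y" if "y \<in> shi_cell n (pos_side ?E x)" for y
      by (rule connected_component_shi_cell[OF x that])
  qed
  also have "\<dots> = shi_cell n ` patterns ?E"
  proof
    show "(\<lambda>x. shi_cell n (pos_side ?E x)) ` topspace ?X \<subseteq> shi_cell n ` patterns ?E"
      by (auto simp: shi_complement_def patterns_def)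
    show "shi_cell n ` patterns ?E \<subseteq> (\<lambda>x. shi_cell n (pos_side ?E x)) ` topspace ?X"
    proof clarify
      fix P assume "P \<in> patterns ?E"
      then obtain x where "x \<in> shi_cell n P" using shi_cell_nonempty by blast
      then show "shi_cell n P \<in> (\<lambda>x. shi_cell n (pos_side ?E x)) ` topspace ?X"
        by (intro image_eqI[of _ _ x]) (auto simp: shi_cell_def)
    qed
  qed
  finally show ?thesis unfolding shi_regions_def X .
qed

text \<open>Transfers region counts to pattern counts for properties constant on cells. Nonemptiness
  of cells makes the quantifier over \<open>C\<close> faithful to \<open>Q\<close> and makes
  \<open>shi_cell\<close> injective on patterns.\<close>

lemma card_shi_regions_where:
  assumes "\<And>P x. P \<in> patterns (shi_edges n) \<Longrightarrow> x \<in> shi_cell n P \<Longrightarrow> R x \<longleftrightarrow> Q P"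
  shows "card {C \<in> shi_regions n. \<forall>x\<in>C. R x} = card {P \<in> patterns (shi_edges n). Q P}"
proof -
  have "{C \<in> shi_regions n. \<forall>x\<in>C. R x} = shi_cell n ` {P \<in> patterns (shi_edges n). Q P}"
    unfolding shi_regions_eq using assms shi_cell_nonempty by blast
  moreover have "inj_on (shi_cell n) {P \<in> patterns (shi_edges n). Q P}"
  proof (rule inj_onI)
    fix P P' assume "P \<in> {P \<in> patterns (shi_edges n). Q P}" "shi_cell n P = shi_cell n P'"
    then obtain x where "x \<in> shi_cell n P" "x \<in> shi_cell n P'" using shi_cell_nonempty by blast
    then show "P = P'" by (simp add: shi_cell_def)
  qed
  ultimately show ?thesis by (simp add: card_image)
qed

lemma shi_counts_eq:
  assumes "n \<ge> 2"
  shows "shi_neg n = card {P \<in> patterns (shi_edges n). (0, 1, 0) \<notin> P}"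
    and "shi_mid n = card {P \<in> patterns (shi_edges n). (0, 1, 0) \<in> P \<and> (0, 1, 1) \<notin> P}"
    and "shi_above n = card {P \<in> patterns (shi_edges n). (0, 1, 1) \<in> P}"
proof -
  have edges: "(0, 1, 0) \<in> shi_edges n" "(0, 1, 1) \<in> shi_edges n" using assms by (auto simp: shi_edges_def)
  have cell: "((0, 1, 0) \<in> P \<longleftrightarrow> x 0 - x 1 > 0) \<and> ((0, 1, 1) \<in> P \<longleftrightarrow> x 0 - x 1 > 1) \<and>
      x 0 - x 1 \<noteq> 0 \<and> x 0 - x 1 \<noteq> 1" if "x \<in> shi_cell n P" for x P
  proof -
    have "hval e x \<noteq> 0" "e \<in> P \<longleftrightarrow> hval e x > 0" if "e \<in> shi_edges n" for e
      using that \<open>x \<in> shi_cell n P\<close> by (auto simp: shi_cell_def shi_complement_def generic_def pos_side_def)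
    from this[OF edges(1)] this[OF edges(2)] show ?thesis by simp
  qed
  show "shi_neg n = card {P \<in> patterns (shi_edges n). (0, 1, 0) \<notin> P}"
    unfolding shi_neg_def
  proof (rule card_shi_regions_where)
    show "x 0 - x 1 < 0 \<longleftrightarrow> (0, 1, 0) \<notin> P" if "x \<in> shi_cell n P" for P x using cell[OF that] by linarith
  qed
  show "shi_mid n = card {P \<in> patterns (shi_edges n). (0, 1, 0) \<in> P \<and> (0, 1, 1) \<notin> P}"
    unfolding shi_mid_def
  proof (rule card_shi_regions_where)
    show "0 < x 0 - x 1 \<and> x 0 - x 1 < 1 \<longleftrightarrow> (0, 1, 0) \<in> P \<and> (0, 1, 1) \<notin> P" if "x \<in> shi_cell n P" for P x
      using cell[OF that] by linarith
  qed
  show "shi_above n = card {P \<in> patterns (shi_edges n). (0, 1, 1) \<in> P}"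
    unfolding shi_above_def
  proof (rule card_shi_regions_where)
    show "x 0 - x 1 > 1 \<longleftrightarrow> (0, 1, 1) \<in> P" if "x \<in> shi_cell n P" for P x using cell[OF that] by linarith
  qed
qed

section \<open>The two partitions\<close>

text \<open>Both sorted triples begin with \<open>g\<close>, and the second partial sum
  \<open>2 * g\<close> on the left is the largest possible when all parts are at most
  \<open>g\<close>.\<close>

lemma majorises_if_two_maximal:
  assumes "e \<le> g" "u \<le> g" "v \<le> g" "2 * g + e = g + u + v"
  shows "majorises (decreasing_sort [g, e, g]) (decreasing_sort [g, u, v])"
proof -
  have "decreasing_sort [g, e, g] = [g, g, e]" using assms(1) by (auto simp: decreasing_sort_def)
  moreover have "decreasing_sort [g, u, v] = (if u \<le> v then [g, v, u] else [g, u, v])"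
    using assms by (auto simp: decreasing_sort_def)
  ultimately show ?thesis using assms by (auto simp: majorises_def)
qed

theorem theorem3:
  fixes n :: nat
  assumes "n \<ge> 2"
  shows "Max {parking_gt n, parking_eq n, parking_lt n} = Max {shi_neg n, shi_mid n, shi_above n}
    \<and> majorises (decreasing_sort [parking_gt n, parking_eq n, parking_lt n])
                (decreasing_sort [shi_neg n, shi_mid n, shi_above n])"
proof -
  have pow: "Suc n ^ (n - 1) = Suc n * Suc n ^ (n - 2)" "Suc n ^ n = Suc n * Suc n ^ (n - 1)"
    using assms by (simp_all only: flip: power_Suc) (simp_all add: Suc_diff_Suc numeral_2_eq_2)
  have eq: "parking_eq n = Suc n ^ (n - 2)"
    using card_parking_eq[OF assms] unfolding pow(1) by (simp only: mult_cancel1) simp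
  have total: "card {a. parking_function n a} = Suc n ^ (n - 1)"
    using card_parking_functions[of n] unfolding pow(2) by (simp only: mult_cancel1) simp
  have lt: "parking_lt n = parking_gt n" using parking_gt_eq_lt[OF assms] by simp
  have gt: "2 * parking_gt n + Suc n ^ (n - 2) = Suc n ^ (n - 1)"
    using parking_total[of n] total eq lt by simp
  note shi = shi_patterns_by_first_difference[OF assms, folded shi_counts_eq[OF assms]]
  \<comment> \<open>Both numbers solve the same equation: twice the number plus
    \<open>(n + 1) ^ (n - 2)\<close> equals \<open>(n + 1) ^ (n - 1)\<close>.\<close>
  have neg: "shi_neg n = parking_gt n" using gt shi(1) by simp
  \<comment> \<open>Here \<open>n \<ge> 2\<close> gives \<open>Suc n \<ge> 3\<close>; as the right
    side is \<open>2 * parking_gt n + parking_eq n\<close>, the equal case cannot exceed the other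
    two.\<close>
  have "3 * Suc n ^ (n - 2) \<le> Suc n ^ (n - 1)" unfolding pow(1) using assms by (intro mult_right_mono) auto
  then have eq_le: "parking_eq n \<le> parking_gt n" using gt eq by simp
  have "Max {parking_gt n, parking_eq n, parking_lt n} = parking_gt n" using eq_le lt by simp
  moreover have "Max {shi_neg n, shi_mid n, shi_above n} = parking_gt n" using shi(3,4) neg by simp
  ultimately show ?thesis
    using majorises_if_two_maximal[OF eq_le, of "shi_mid n" "shi_above n"] shi gt neg eq lt by simp
qed

end
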